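(* For unweighted online stochastic matching with integral arrival rates and uniform stochastic rewards (defined in the context), for every constant $p\in(0,1]$ there exists an adaptive online algorithm achieving competitive ratio at least $0.702$ (asymptotically as $n\to\infty$).
   Context: Model: bipartite graph $G=(U,V,E)$ with $|V|=n$, $U$ offline; there are $n$ online rounds, in each round a vertex of $V$ is drawn independently and uniformly at random (integral arrival rates, normalized so each $r_v=1$). All edges have weight $1$ and a common constant probability $p\in(0,1]$ (independent of the problem size). When an arriving $v$ is assigned (probed) to an available neighbor $u$, independently the edge is present with probability $p$, in which case $u$ becomes matched and reward $1$ is obtained; otherwise nothing is gained for this arrival. Each $u$ can be matched at most once; decisions are immediate and irrevocable. An adaptive algorithm may base its actions on the realizations so far. The competitive ratio is $\mathbb{E}[\mathrm{ALG}]/\mathbb{E}[\mathrm{OPT}]$ where $\mathrm{OPT}$ is the optimal offline value (the offline algorithm knowing the arrival sequence), analyzed asymptotically as $n\to\infty$ with $o(1)$ terms ignored. *)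

theory Defs
  imports "HOL-Probability.Probability"
begin

section \<open>Instances\<close>

record ('u, 'v) bigraph =
  Offline :: "'u set"
  Online :: "'v set"
  Edges :: "('u \<times> 'v) set"

definition bipartite_graph :: "('u, 'v) bigraph \<Rightarrow> bool" where
  "bipartite_graph G \<longleftrightarrow>
     finite (Offline G) \<and> finite (Online G) \<and> Edges G \<subseteq> Offline G \<times> Online G"


section \<open>Online algorithms\<close>

text \<open>
  One entry per past round: the arrived vertex, the offline vertex it was assigned to
  (if any), and whether the probed edge turned out to be present.
\<close>
type_synonym ('u, 'v) history = "('v \<times> 'u option \<times> bool) list"

text \<open>
  An algorithm knows the graph in advance. In each round it sees the complete history and
  the arriving vertex, and chooses (possibly at random) an assignment or no assignment.
\<close>
type_synonym ('u, 'v) online_algorithm =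
  "('u, 'v) bigraph \<Rightarrow> ('u, 'v) history \<Rightarrow> 'v \<Rightarrow> 'u option pmf"

definition matched :: "('u, 'v) history \<Rightarrow> 'u set" where
  "matched h = {u. \<exists>v. (v, Some u, True) \<in> set h}"

definition admissible :: "('u, 'v) online_algorithm \<Rightarrow> bool" where
  "admissible A \<longleftrightarrow>
     (\<forall>G h v. \<forall>u. Some u \<in> set_pmf (A G h v) \<longrightarrow>
        u \<in> Offline G - matched h \<and> (u, v) \<in> Edges G)"

definition online_round ::
  "real \<Rightarrow> ('u, 'v) online_algorithm \<Rightarrow> ('u, 'v) bigraph \<Rightarrow> ('u, 'v) history \<Rightarrow> ('u, 'v) history pmf"
where
  "online_round p A G h =
     bind_pmf (pmf_of_set (Online G)) (\<lambda>v.
     bind_pmf (A G h v) (\<lambda>a.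
     bind_pmf (case a of None \<Rightarrow> return_pmf False | Some u \<Rightarrow> bernoulli_pmf p) (\<lambda>present.
     return_pmf (h @ [(v, a, present)]))))"

primrec online_run ::
  "real \<Rightarrow> ('u, 'v) online_algorithm \<Rightarrow> ('u, 'v) bigraph \<Rightarrow> nat \<Rightarrow> ('u, 'v) history pmf"
where
  "online_run p A G 0 = return_pmf []"
| "online_run p A G (Suc t) = bind_pmf (online_run p A G t) (online_round p A G)"

text \<open>The number of rounds equals the number of online vertices, so each arrival rate is 1.\<close>
definition expected_ALG ::
  "real \<Rightarrow> ('u, 'v) online_algorithm \<Rightarrow> ('u, 'v) bigraph \<Rightarrow> real" where
  "expected_ALG p A G =
     measure_pmf.expectation (online_run p A G (card (Online G))) (\<lambda>h. real (card (matched h)))"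


section \<open>The offline optimum\<close>

text \<open>
  The offline algorithm knows the arrival sequence, but it learns whether an edge is present
  only by probing it. It may treat the arrivals in any order and adapt to the outcomes, but
  each arrival is assigned at most once. Such an algorithm is a decision tree:
  in \<open>Probe t u s f\<close>, the arrival of round \<open>t\<close> is assigned to \<open>u\<close>, and the algorithm continues
  with \<open>s\<close> if the edge is present and with \<open>f\<close> otherwise. Randomization would not help,
  as a randomized algorithm is a mixture of such trees.
\<close>
datatype 'u offline_algorithm =
  Stop
| Probe nat 'u "'u offline_algorithm" "'u offline_algorithm"

text \<open>\<open>R\<close> is the set of rounds not yet used, \<open>S\<close> the set of offline vertices still available.\<close>
primrec feasible ::
  "('u \<times> 'v) set \<Rightarrow> 'v list \<Rightarrow> nat set \<Rightarrow> 'u set \<Rightarrow> 'u offline_algorithm \<Rightarrow> bool" where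
  "feasible E vs R S Stop \<longleftrightarrow> True"
| "feasible E vs R S (Probe t u s f) \<longleftrightarrow>
     t \<in> R \<and> u \<in> S \<and> (u, vs ! t) \<in> E \<and>
     feasible E vs (R - {t}) (S - {u}) s \<and> feasible E vs (R - {t}) S f"

primrec expected_reward :: "real \<Rightarrow> 'u offline_algorithm \<Rightarrow> real" where
  "expected_reward p Stop = 0"
| "expected_reward p (Probe t u s f) =
     p * (1 + expected_reward p s) + (1 - p) * expected_reward p f"

definition OPT :: "real \<Rightarrow> ('u, 'v) bigraph \<Rightarrow> 'v list \<Rightarrow> real" where
  "OPT p G vs =
     (SUP T \<in> {T. feasible (Edges G) vs {..<length vs} (Offline G) T}. expected_reward p T)"

definition expected_OPT :: "real \<Rightarrow> ('u, 'v) bigraph \<Rightarrow> real" where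
  "expected_OPT p G =
     measure_pmf.expectation (replicate_pmf (card (Online G)) (pmf_of_set (Online G))) (OPT p G)"

definition competitive_ratio ::
  "real \<Rightarrow> ('u, 'v) online_algorithm \<Rightarrow> ('u, 'v) bigraph \<Rightarrow> real" where
  "competitive_ratio p A G = expected_ALG p A G / expected_OPT p G"

text \<open>The supremum in \<open>OPT\<close> is over a nonempty set that is bounded above.\<close>

lemma expected_reward_le:
  assumes "0 \<le> p" "p \<le> 1" "finite R" "feasible E vs R S T"
  shows "expected_reward p T \<le> real (card R)"
  using assms(3,4)
proof (induction T arbitrary: R S)
  case Stop
  then show ?case by simp
next
  case (Probe t u s f)
  have c: "real (card R) = 1 + real (card (R - {t}))"
    using Probe.prems by (metis card_Suc_Diff1 feasible.simps(2) of_nat_Suc add.commute)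
  have s: "expected_reward p s \<le> real (card (R - {t}))"
    and f: "expected_reward p f \<le> real (card (R - {t}))"
    using Probe.IH(1)[of "R - {t}" "S - {u}"] Probe.IH(2)[of "R - {t}" S] Probe.prems
    by (simp_all del: card_Diff_insert card_Diff_singleton)
  have "p * (1 + expected_reward p s) \<le> p * real (card R)"
    using s c assms(1) by (intro mult_left_mono) auto
  moreover have "(1 - p) * expected_reward p f \<le> (1 - p) * real (card R)"
    using f c assms(2) by (intro mult_left_mono) auto
  ultimately show ?case by (simp add: algebra_simps)
qed

lemma OPT_bdd_above:
  assumes "0 \<le> p" "p \<le> 1"
  shows "bdd_above (expected_reward p ` {T. feasible E vs {..<length vs} S T})"
  using expected_reward_le[OF assms, of "{..<length vs}"] by (intro bdd_aboveI2) auto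

lemma OPT_nonempty: "{T. feasible E vs R S T} \<noteq> {}"
  using feasible.simps(1) by blast

end

(*
  Let f u v be the expected number of times that the offline optimum matches u with an arrival of
  type v, and y u = sum_v f u v. Then sum_u f u v <= p, and for every set X of types
  sum_{v in X} f u v <= 1 - (1 - p |X| / n)^n, since some arrival in X has to succeed with u.

  The online algorithm draws, for an arrival of type v, a pair (a, b) from a symmetric distribution
  whose marginals are f u v / p and for which a = b is as unlikely as possible; it probes a if a is
  still free, and b otherwise. The constraint on the sets X gives sum_v max(0, 2 f u v - p) <=
  1 - ln 2 + o(1), so u is a proper second choice at rate s u >= y u - (1 - ln 2) - o(1).

  Two vertices u, w are both free after k rounds with probability at most (1 - (y u + y w) / n)^k.
  Hence, while u is free, the first choice w of a pair (w, u) is often already taken, which yields a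
  linear recursion for the probability that u is free. Up to o(1) and after summation over u (using
  the symmetry of the pairs) the expected number of matched vertices is at least
  sum_u (1 - exp(- y u) + e^-1 (e^-1 y u s u - (1/2 - e^-1) (s u)^2)) >= 0.702 sum_u y u.
*)
theory Submission
  imports Defs
begin

section \<open>Numerical bounds\<close>

lemma exp_ge_partial_sum:
  fixes x :: real
  assumes "0 \<le> x"
  shows "(\<Sum>i<k. x ^ i / fact i) \<le> exp x"
proof -
  have "(\<Sum>i<k. inverse (fact i) *\<^sub>R x ^ i) \<le> (\<Sum>i. inverse (fact i) *\<^sub>R x ^ i)"
    using assms by (intro sum_le_suminf summable_exp_generic) auto
  then show ?thesis by (simp add: exp_def field_simps)
qed

lemma ln2_ge: "0.693 \<le> ln (2::real)"
  using ln_approx_bounds[of 2 3] by (simp add: eval_nat_numeral)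

lemma exp_minus_3_4: "exp (- 3 / 4 :: real) \<le> 0.473"
proof -
  have "(2.1143 :: real) \<le> (\<Sum>i<5. (3/4) ^ i / fact i)"
    by (simp add: eval_nat_numeral fact_numeral)
  also have "\<dots> \<le> exp (3/4)" by (rule exp_ge_partial_sum) simp
  finally have "inverse (exp (3/4 :: real)) \<le> inverse 2.1143" by (intro le_imp_inverse_le) auto
  then show ?thesis by (simp add: exp_minus)
qed

lemma exp_minus_1: "exp (- 1 :: real) \<le> 0.3679" "exp (- 1 :: real) > 0.3675"
proof -
  have "(2.7182 :: real) \<le> (\<Sum>i<8. 1 ^ i / fact i)"
    by (simp add: eval_nat_numeral fact_numeral)
  also have "\<dots> \<le> exp 1" by (rule exp_ge_partial_sum) simp
  finally have "inverse (exp (1 :: real)) \<le> inverse 2.7182" by (intro le_imp_inverse_le) auto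
  then show "exp (- 1 :: real) \<le> 0.3679" by (simp add: exp_minus)
  have "inverse 2.72 < inverse (exp (1 :: real))" using e_less_272 by (intro less_imp_inverse_less) auto
  then show "exp (- 1 :: real) > 0.3675" by (simp add: exp_minus)
qed

lemma exp_minus_chord:
  fixes y a b :: real
  assumes "a \<le> y" "y \<le> b" "a < b"
  shows "exp (- y) \<le> ((b - y) * exp (- a) + (y - a) * exp (- b)) / (b - a)"
proof -
  define t where "t = (y - a) / (b - a)"
  have t: "0 \<le> t" "t \<le> 1" using assms by (auto simp: t_def field_simps)
  have "t * (b - a) = y - a" using assms by (simp add: t_def)
  then have y: "y = (1 - t) * a + t * b" by (simp add: algebra_simps)
  have "exp ((1 - t) *\<^sub>R (- a) + t *\<^sub>R (- b)) \<le> (1 - t) * exp (- a) + t * exp (- b)"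
    using t by (intro convex_onD[OF exp_convex]) auto
  moreover have "(1 - t) *\<^sub>R (- a) + t *\<^sub>R (- b) = - y" by (simp add: y algebra_simps)
  moreover have "(1 - t) = (b - y) / (b - a)" using assms by (simp add: t_def field_simps)
  ultimately show ?thesis using assms by (simp add: t_def add_divide_distrib)
qed

text \<open>Convexity puts \<open>exp (- y)\<close> below its chord over [0, 3/4], and 4/3 * (1 -
  0.473) still exceeds 0.702. For such \<open>y\<close> the first choices alone give the
  ratio.\<close>

lemma single_choice_ratio:
  fixes y :: real
  assumes "0 \<le> y" "y \<le> 3 / 4"
  shows "0.702 * y \<le> 1 - exp (- y)"
proof -
  have "exp (- y) \<le> ((3/4 - y) * exp (- 0) + (y - 0) * exp (- (3/4))) / (3/4 - 0)"
    using assms by (intro exp_minus_chord) auto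
  also have "\<dots> = 1 - 4 / 3 * y * (1 - exp (- 3/4))" by (simp add: field_simps)
  also have "\<dots> \<le> 1 - 4 / 3 * y * (1 - 0.473)"
    using assms exp_minus_3_4 by (intro diff_left_mono mult_left_mono) auto
  also have "\<dots> \<le> 1 - 0.702 * y" using assms by simp
  finally show ?thesis by simp
qed

text \<open>
  In the limit \<open>Q\<close> is \<open>exp (- 1)\<close>. The worst case is \<open>y = 1\<close> with \<open>s\<close> close to \<open>ln 2\<close>, where the right-hand
  side is about 0.7026.
\<close>

lemma two_choice_ratio:
  fixes y s Q :: real
  assumes y: "0 \<le> y" "y \<le> 1" and s: "0 \<le> s" "s \<le> y" "y - 0.3075 \<le> s"
    and Q: "0.3675 \<le> Q" "Q \<le> 1 / 2"
  shows "0.702 * y \<le> 1 - exp (- y) + Q * (Q * (y * s) - (1 / 2 - Q) * s\<^sup>2)"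
proof -
  have ss: "s\<^sup>2 \<le> y * s" using s by (simp add: power2_eq_square mult_right_mono)
  have ys: "0 \<le> y * s" using y s by simp
  \<comment> \<open>The right-hand side is linear and nondecreasing in \<open>Q\<close>, so
    \<open>Q\<close> may be lowered to 0.3675; the constant 0.1325 is 1/2 - 0.3675.\<close>
  have mono: "0.3675 * (y * s) - 0.1325 * s\<^sup>2 \<le> Q * (y * s) - (1 / 2 - Q) * s\<^sup>2"
  proof -
    have "0 \<le> (Q - 0.3675) * (y * s + s\<^sup>2)" using Q ys by simp
    then show ?thesis by (simp add: algebra_simps)
  qed
  have pos: "0 \<le> 0.3675 * (y * s) - 0.1325 * s\<^sup>2" using ss ys by simp
  have low: "0.3675 * (0.3675 * (y * s) - 0.1325 * s\<^sup>2) \<le> Q * (Q * (y * s) - (1 / 2 - Q) * s\<^sup>2)"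
    using Q mono pos by (intro mult_mono) auto
  show ?thesis
  proof (cases "y \<le> 3 / 4")
    case True
    then show ?thesis using single_choice_ratio[of y] y low pos by simp
  next
    case False
    \<comment> \<open>The smallest value allowed for \<open>s\<close>. The quadratic in
      \<open>s\<close> grows from \<open>r\<close> to \<open>s\<close>, because both are at most
      \<open>y\<close>, so passing to \<open>r\<close> only lowers the bound.\<close>
    define r where "r = y - 0.3075"
    have "exp (- y) \<le> ((1 - y) * exp (- (3/4)) + (y - 3/4) * exp (- 1)) / (1 - 3/4)"
      using y False by (intro exp_minus_chord) auto
    also have "\<dots> \<le> ((1 - y) * 0.473 + (y - 3/4) * 0.3679) / (1 - 3/4)"
      using y False exp_minus_3_4 exp_minus_1
      by (intro divide_right_mono add_mono mult_left_mono) auto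
    finally have e: "exp (- y) \<le> 4 * ((1 - y) * 0.473 + (y - 3/4) * 0.3679)" by simp
    have "0 \<le> (s - r) * (0.3675 * y - 0.1325 * (s + r))"
      using s False y by (intro mult_nonneg_nonneg) (auto simp: r_def)
    then have "0.3675 * (y * r) - 0.1325 * r\<^sup>2 \<le> 0.3675 * (y * s) - 0.1325 * s\<^sup>2"
      by (simp add: field_simps power2_eq_square)
    then have sr: "0.3675 * (0.3675 * (y * r) - 0.1325 * r\<^sup>2) \<le> 0.3675 * (0.3675 * (y * s) - 0.1325 * s\<^sup>2)"
      by (intro mult_left_mono) auto
    have "0.702 * y \<le> 1 - 4 * ((1 - y) * 0.473 + (y - 3/4) * 0.3679)
        + 0.3675 * (0.3675 * (y * r) - 0.1325 * r\<^sup>2)"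
    proof -
      \<comment> \<open>Expanded around the worst case \<open>y = 1\<close>, the difference has only
        positive coefficients.\<close>
      define z where "z = 1 - y"
      have z: "0 \<le> z" using y by (simp add: z_def)
      have "1 - 4 * ((1 - y) * 0.473 + (y - 3/4) * 0.3679)
          + 0.3675 * (0.3675 * (y * r) - 0.1325 * r\<^sup>2) - 0.702 * y
        = 7041561 / 25600000000 + 7709321 / 64000000 * z + 6909 / 80000 * z\<^sup>2"
        unfolding r_def z_def power2_eq_square by (simp add: field_simps)
      moreover have "\<dots> \<ge> 0" using z by simp
      ultimately show ?thesis by linarith
    qed
    also have "\<dots> \<le> 1 - exp (- y) + Q * (Q * (y * s) - (1 / 2 - Q) * s\<^sup>2)"
      by (intro add_mono diff_left_mono order_trans[OF sr low] e)
    finally show ?thesis .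
  qed
qed

text \<open>From \<open>1 + x \<le> exp x\<close> comes
  \<open>exp (- x) * (1 - x^2) \<le> 1 - x\<close>. The n-th power and the Bernoulli inequality turn
  this into an explicit rate for the limit \<open>exp (- m)\<close>.\<close>

lemma exp_minus_squeeze:
  fixes m :: real
  assumes "0 \<le> m" "m \<le> real n" "n > 0"
  shows "exp (- m) - m\<^sup>2 / n * exp (- m) \<le> (1 - m / n) ^ n"
proof -
  define x where "x = m / n"
  have x: "0 \<le> x" "x \<le> 1" using assms by (auto simp: x_def)
  have "exp (- x) * (1 - x\<^sup>2) \<le> 1 - x"
  proof -
    have "exp (- x) * (1 + x) \<le> exp (- x) * exp x" by (intro mult_left_mono) auto
    also have "\<dots> = 1" by (simp add: exp_minus)
    finally have "(exp (- x) * (1 + x)) * (1 - x) \<le> 1 * (1 - x)"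
      using x by (intro mult_right_mono) auto
    then show ?thesis by (simp add: algebra_simps power2_eq_square)
  qed
  then have pw: "(exp (- x) * (1 - x\<^sup>2)) ^ n \<le> (1 - x) ^ n"
    using x by (intro power_mono) (auto simp: power_le_one)
  have em: "exp (- x) ^ n = exp (- m)"
    using assms by (simp add: exp_of_nat_mult[symmetric] x_def)
  have "1 - m\<^sup>2 / n \<le> (1 - x\<^sup>2) ^ n"
  proof -
    have "1 + real n * (- x\<^sup>2) \<le> (1 + (- x\<^sup>2)) ^ n"
      using x by (intro Bernoulli_inequality) (auto simp: power_le_one)
    then show ?thesis using assms by (simp add: x_def power2_eq_square field_simps)
  qed
  then have "exp (- m) * (1 - m\<^sup>2 / n) \<le> exp (- m) * (1 - x\<^sup>2) ^ n"
    by (intro mult_left_mono) auto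
  moreover have "exp (- m) * (1 - x\<^sup>2) ^ n \<le> (1 - x) ^ n"
    using pw by (simp add: power_mult_distrib em)
  ultimately have "exp (- m) * (1 - m\<^sup>2 / n) \<le> (1 - x) ^ n" by (rule order_trans)
  then show ?thesis by (simp add: x_def algebra_simps)
qed

text \<open>As \<open>n\<close> grows the bound tends to \<open>1 - ln 2\<close>, the maximum of \<open>2 * (1 - exp (- m)) - m\<close>.\<close>

lemma overlap_bound:
  fixes m z :: real
  assumes m: "0 \<le> m" "m \<le> real n" and z: "z \<le> 1 - (1 - m / n) ^ n" and n: "16000 \<le> n"
  shows "2 * z - m \<le> 0.3075"
proof (cases "m \<le> 2")
  case True
  have "m\<^sup>2 / n * exp (- m) \<le> 4 / 16000 * 1"
    using True m n power_mono[of m 2 2] by (intro mult_mono frac_le) auto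
  \<comment> \<open>The error enters the conclusion doubled, as 0.0005, which is exactly the gap
    between 1 - 0.693 and 0.3075. This fixes the threshold 16000.\<close>
  then have "exp (- m) - 4 / 16000 \<le> (1 - m / n) ^ n"
    using exp_minus_squeeze[OF m] n by linarith
  \<comment> \<open>The tangent of \<open>exp (- m)\<close> at the maximiser
    \<open>m = ln 2\<close>.\<close>
  moreover have "exp (- m) \<ge> (1 + (ln 2 - m)) / 2"
  proof -
    have "1 + (ln 2 - m) \<le> exp (ln 2 - m)" by simp
    also have "\<dots> = 2 * exp (- m)" by (simp add: exp_diff exp_minus field_simps)
    finally show ?thesis by simp
  qed
  ultimately show ?thesis using z ln2_ge by simp
next
  case False
  have "0 \<le> (1 - m / n) ^ n" using m n by (intro zero_le_power) (auto simp: field_simps)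
  then show ?thesis using False z by simp
qed

text \<open>The left-hand side is convex in \<open>y\<close>, and both sides agree at
  \<open>y = 0\<close> and \<open>y = 1\<close>. A bound linear in \<open>y\<close> lets the sum
  over all first choices collapse into the single number \<open>Y u\<close>.\<close>

lemma power_one_minus_le_interpolation:
  fixes y :: real
  assumes "0 \<le> y" "y \<le> 1" "1 \<le> n"
  shows "(1 - y / n) ^ k \<le> 1 - y * (1 - (1 - 1 / n) ^ k)"
proof (induction k)
  case (Suc k)
  define q where "q = (1 - 1 / n :: real)"
  have q: "0 \<le> q ^ k" "q ^ k \<le> 1" using assms by (auto simp: q_def power_le_one)
  have yn: "0 \<le> 1 - y / n" using assms by (simp add: field_simps)
  have "0 \<le> (y / n) * ((1 - y) * (1 - q ^ k))"
    using assms q by (intro mult_nonneg_nonneg) auto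
  moreover have "y * q ^ Suc k = y * q ^ k - y * q ^ k / n" by (simp add: q_def algebra_simps)
  ultimately have "(1 - y / n) * (1 - y * (1 - q ^ k)) \<le> 1 - y * (1 - q ^ Suc k)"
    by (simp add: algebra_simps del: power_Suc)
  moreover have "(1 - y / n) ^ Suc k \<le> (1 - y / n) * (1 - y * (1 - q ^ k))"
    using Suc yn by (simp add: q_def mult_left_mono)
  ultimately show ?case by (simp add: q_def)
qed simp

text \<open>
  Dividing \<open>P k\<close> by \<open>(1 - y / n) ^ k\<close> leaves a linear recursion for the effect of the second choices;
  \<open>Y * (a k - s * b k)\<close> bounds its solution from below, exactly to second order in the rates \<open>Y\<close>, \<open>s\<close>
  up to an error of order \<open>1 / n\<close>.
\<close>

lemma two_choice_recursion:
  fixes P G :: "nat \<Rightarrow> real" and y s Y q :: real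
  assumes n: "2 \<le> n" and y: "0 \<le> y" "y \<le> 1" and s: "0 \<le> s" "s \<le> 1" and Y: "0 \<le> Y"
    and q: "q = 1 - 1 / n"
    and P0: "P 0 = 1"
    and rec: "\<And>k. P (Suc k) \<le> (1 - y / n) * P k - (s * P k - G k) / n"
    and G_le: "\<And>k. G k \<le> s * P k"
    and G_bound: "\<And>k. G k \<le> (1 - y / n) ^ k * (s - Y * (1 - q ^ k))"
  shows "P n \<le> (1 - y / n) ^ n * (1 - Y * (q ^ n - s * (1 / 2 - q ^ n)))"
proof -
  define \<alpha> where "\<alpha> = 1 - y / n"
  \<comment> \<open>\<open>a k\<close> is the sum of \<open>(1 - q ^ i) / n\<close> over
    \<open>i < k\<close>, and \<open>b k\<close> is the sum of the \<open>a i / n\<close> plus a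
    surplus of order 1 / n for \<open>k\<close> up to \<open>n\<close>: the first two terms of the
    iterated solution.\<close>
  define a where "a k = k / n - (1 - q ^ k)" for k :: nat
  define b where "b k = (k / n)\<^sup>2 / 2 - k / n + (1 - q ^ k)" for k :: nat
  define c where "c k = Y * (a k - s * b k)" for k
  have n0: "0 < real n" using n by simp
  have \<alpha>: "0 \<le> \<alpha>" "\<alpha> \<le> 1" using y n by (auto simp: \<alpha>_def field_simps)
  have q01: "0 \<le> q" "q \<le> 1" using n by (auto simp: q field_simps)
  have a_Suc: "a (Suc k) = a k + (1 - q ^ k) / n" for k
  proof -
    have "q ^ k - q ^ Suc k = q ^ k / n" by (simp add: q algebra_simps)
    then show ?thesis by (simp add: a_def add_divide_distrib diff_divide_distrib)
  qed
  have a_nonneg: "0 \<le> a k" for k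
  proof (induction k)
    case (Suc k)
    then show ?case using q01 n0 by (simp add: a_Suc power_le_one)
  qed (simp add: a_def)
  have b_Suc: "b k + a k / n \<le> b (Suc k)" for k
  proof -
    have "q ^ Suc k = q ^ k - q ^ k / n" by (simp add: q algebra_simps)
    then have "b (Suc k) = b k + a k / n + (1 / n)\<^sup>2 / 2"
      by (simp add: a_def b_def add_divide_distrib diff_divide_distrib power2_eq_square algebra_simps)
    then show ?thesis by simp
  qed
  have b_nonneg: "0 \<le> b k" for k
  proof (induction k)
    case (Suc k)
    then show ?case using a_nonneg[of k] n0 b_Suc[of k] by (smt (verit) divide_nonneg_pos)
  qed (simp add: b_def)
  \<comment> \<open>\<open>c\<close> is a subsolution of the linear recursion: the surplus of
    \<open>b\<close> and the third-order term \<open>Y * s * s * b k / n\<close> are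
    dropped.\<close>
  have c_Suc: "c (Suc k) \<le> c k - c k * s / n + Y * (1 - q ^ k) / n" for k
  proof -
    have "0 \<le> Y * s * (b (Suc k) - b k - a k / n) + Y * s * (s * b k / n)"
      using Y s b_Suc[of k] b_nonneg[of k] n0 by (intro add_nonneg_nonneg mult_nonneg_nonneg) auto
    then show ?thesis by (simp add: c_def a_Suc algebra_simps diff_divide_distrib add_divide_distrib)
  qed
  have main: "P k \<le> \<alpha> ^ k * (1 - c k)" for k
  proof (induction k)
    case 0
    then show ?case by (simp add: P0 c_def a_def b_def)
  next
    case (Suc k)
    have sn: "s / n \<le> 1" using s n by (simp add: field_simps)
    have "P (Suc k) \<le> \<alpha> * P k - (s * P k - G k) / n" using rec[of k] by (simp add: \<alpha>_def)
    \<comment> \<open>The second-choice loss is nonnegative by \<open>G_le\<close>, so shrinking it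
      by \<open>\<alpha>\<close> only weakens the bound and lets \<open>\<alpha>\<close> be pulled
      out.\<close>
    also have "\<dots> \<le> \<alpha> * P k - \<alpha> * ((s * P k - G k) / n)"
      using \<alpha> G_le[of k] n0 by (intro diff_left_mono mult_left_le_one_le) auto
    also have "\<dots> = \<alpha> * ((1 - s / n) * P k + G k / n)"
      by (simp add: algebra_simps diff_divide_distrib)
    also have "\<dots> \<le> \<alpha> * ((1 - s / n) * (\<alpha> ^ k * (1 - c k)) + \<alpha> ^ k * (s - Y * (1 - q ^ k)) / n)"
      using Suc sn \<alpha> G_bound[of k] n0
      by (intro mult_left_mono add_mono divide_right_mono) (auto simp: \<alpha>_def)
    also have "\<dots> = \<alpha> ^ Suc k * (1 - (c k - c k * s / n + Y * (1 - q ^ k) / n))"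
      by (simp add: algebra_simps diff_divide_distrib add_divide_distrib)
    also have "\<dots> \<le> \<alpha> ^ Suc k * (1 - c (Suc k))"
      using c_Suc[of k] \<alpha> by (intro mult_left_mono) auto
    finally show ?case .
  qed
  \<comment> \<open>At \<open>k = n\<close> the terms \<open>k / n\<close> become 1, leaving
    \<open>a n = q ^ n\<close> and \<open>b n = 1 / 2 - q ^ n\<close>.\<close>
  have "c n = Y * (q ^ n - s * (1 / 2 - q ^ n))" using n0 by (simp add: c_def a_def b_def)
  with main[of n] show ?thesis by (simp add: \<alpha>_def)
qed

section \<open>Symmetric couplings\<close>

text \<open>The prescribed diagonal is the smallest one that row sums \<open>g\<close> allow.\<close>

definition symmetric_coupling :: "'a set \<Rightarrow> ('a \<Rightarrow> real) \<Rightarrow> ('a \<Rightarrow> 'a \<Rightarrow> real) \<Rightarrow> bool" where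
  "symmetric_coupling I g j \<longleftrightarrow>
     (\<forall>a\<in>I. \<forall>b\<in>I. 0 \<le> j a b \<and> j a b = j b a) \<and>
     (\<forall>a\<in>I. (\<Sum>b\<in>I. j a b) = g a) \<and>
     (\<forall>a\<in>I. j a a = max 0 (2 * g a - sum g I))"

text \<open>When \<open>i\<close> carries at least half of the mass, every other entry is paired
  with \<open>i\<close>, and what \<open>i\<close> has left goes to the pair
  \<open>(i, i)\<close>.\<close>

lemma symmetric_coupling_star:
  assumes I: "finite I" and g: "\<And>a. a \<in> I \<Longrightarrow> 0 \<le> g a" and i: "i \<in> I" "sum g I \<le> 2 * g i"
  shows "\<exists>j. symmetric_coupling I g j"
proof -
  define j where "j a b = (if a = i then if b = i then 2 * g i - sum g I else g b
    else if b = i then g a else 0)" for a b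
  have I': "sum g (I - {i}) = sum g I - g i" using I i by (simp add: sum_diff1)
  have "(\<Sum>b\<in>I. j a b) = g a" if "a \<in> I" for a
  proof -
    have "(\<Sum>b\<in>I. j a b) = j a i + (\<Sum>b\<in>I - {i}. j a b)" using I i by (simp add: sum.remove)
    also have "\<dots> = g a"
    proof (cases "a = i")
      case True
      then have "(\<Sum>b\<in>I - {i}. j a b) = sum g (I - {i})" by (intro sum.cong) (auto simp: j_def)
      then show ?thesis using True I' by (simp add: j_def)
    next
      case False
      then have "(\<Sum>b\<in>I - {i}. j a b) = 0" by (intro sum.neutral) (auto simp: j_def)
      then show ?thesis using False by (simp add: j_def)
    qed
    finally show ?thesis .
  qed
  moreover have "j a a = max 0 (2 * g a - sum g I)" if "a \<in> I" for a
  proof (cases "a = i")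
    case False
    have "g a \<le> sum g (I - {i})" using False that I g by (intro member_le_sum) auto
    then show ?thesis using False i I' by (simp add: j_def)
  qed (use i in \<open>simp add: j_def\<close>)
  ultimately have "symmetric_coupling I g j"
    using g i by (auto simp: symmetric_coupling_def j_def)
  then show ?thesis by blast
qed

text \<open>
  If no entry of \<open>g\<close> exceeds half of the total, mass \<open>\<delta>\<close> is put on a pair of positive entries until one
  of them vanishes (smaller support) or another entry becomes half of the total (star).
\<close>

lemma symmetric_coupling_exists:
  assumes "finite I" and "\<And>a. a \<in> I \<Longrightarrow> 0 \<le> g a"
  shows "\<exists>j. symmetric_coupling I g j"
  using assms(2)
proof (induction "card {a \<in> I. g a \<noteq> 0}" arbitrary: g rule: less_induct)
  case less
  note I = \<open>finite I\<close> and g = less.prems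
  show ?case
  proof (cases "\<exists>i\<in>I. sum g I \<le> 2 * g i")
    case True
    then obtain i where "i \<in> I" "sum g I \<le> 2 * g i" by blast
    then show ?thesis by (intro symmetric_coupling_star[OF I g])
  next
    case False
    then have small: "2 * g a < sum g I" if "a \<in> I" for a using False that by (meson not_le)
    show ?thesis
    proof (cases "I = {}")
      case True
      then have "symmetric_coupling I g (\<lambda>_ _. 0)" by (simp add: symmetric_coupling_def)
      then show ?thesis by blast
    next
      case I_ne: False
      then have tot: "0 < sum g I" using small g by fastforce
      have "\<exists>i\<in>I. 0 < g i"
      proof (rule ccontr)
        assume "\<not> ?thesis"
        then have "sum g I \<le> 0" by (intro sum_nonpos) force
        then show False using tot by simp
      qed
      then obtain i where i: "i \<in> I" "0 < g i" by blast
      have "\<exists>k\<in>I - {i}. 0 < g k"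
      proof (rule ccontr)
        assume "\<not> ?thesis"
        then have "sum g (I - {i}) \<le> 0" by (intro sum_nonpos) force
        moreover have "sum g (I - {i}) = sum g I - g i" using I i by (simp add: sum_diff1)
        ultimately show False using small[of i] i by simp
      qed
      then obtain k where k: "k \<in> I" "k \<noteq> i" "0 < g k" by blast
      \<comment> \<open>The values of \<open>\<delta>\<close> at which \<open>g i\<close> or
        \<open>g k\<close> is used up, or some other \<open>g l\<close> reaches half of the reduced
        total \<open>sum g I - 2 * \<delta>\<close>. The entries \<open>i\<close> and
        \<open>k\<close> shrink as fast as that half and stay below it.\<close>
      define S where "S = {g i, g k} \<union> (\<lambda>l. sum g I / 2 - g l) ` (I - {i, k})"
      define \<delta> where "\<delta> = Min S"
      have S: "finite S" "S \<noteq> {}" using I by (auto simp: S_def)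
      have \<delta>_in: "\<delta> \<in> S" unfolding \<delta>_def using S by (rule Min_in)
      have \<delta>_le: "\<delta> \<le> t" if "t \<in> S" for t unfolding \<delta>_def using S that by (intro Min_le) auto
      have \<delta>_pos: "0 < \<delta>" using \<delta>_in i k small by (force simp: S_def)
      define h where "h = g(i := g i - \<delta>, k := g k - \<delta>)"
      have h_nonneg: "0 \<le> h a" if "a \<in> I" for a
        using that g \<delta>_le[of "g i"] \<delta>_le[of "g k"] k by (auto simp: h_def S_def)
      have split: "sum f I = f i + f k + sum f (I - {i, k})" for f :: "'a \<Rightarrow> real"
      proof -
        have "I = insert i (insert k (I - {i, k}))" using i k by auto
        then have "sum f I = sum f (insert i (insert k (I - {i, k})))" by simp
        also have "\<dots> = f i + f k + sum f (I - {i, k})" using I k by (simp add: add.assoc)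
        finally show ?thesis .
      qed
      have "sum h (I - {i, k}) = sum g (I - {i, k})" by (intro sum.cong) (auto simp: h_def)
      then have h_sum: "sum h I = sum g I - 2 * \<delta>"
        using split[of h] split[of g] k by (simp add: h_def)
      have diag: "2 * h a \<le> sum h I" if "a \<in> I" for a
      proof (cases "a = i \<or> a = k")
        case True
        then show ?thesis using small[OF that] k unfolding h_sum by (auto simp: h_def)
      next
        case False
        then have "\<delta> \<le> sum g I / 2 - g a" using that by (intro \<delta>_le) (auto simp: S_def)
        then show ?thesis using False unfolding h_sum by (simp add: h_def)
      qed
      have "\<exists>j. symmetric_coupling I h j"
      proof (cases "\<delta> = g i \<or> \<delta> = g k")
        case True
        have hg: "g a \<noteq> 0" if "h a \<noteq> 0" for a
        proof (cases "a = i \<or> a = k")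
          case False
          then show ?thesis using that by (simp add: h_def)
        qed (use i k in auto)
        obtain l where l: "l \<in> I" "g l \<noteq> 0" "h l = 0"
        proof (cases "\<delta> = g i")
          case True
          then show ?thesis using that[of i] i k by (simp add: h_def)
        next
          case False
          then show ?thesis using that[of k] k \<open>\<delta> = g i \<or> \<delta> = g k\<close> by (simp add: h_def)
        qed
        have "{a \<in> I. h a \<noteq> 0} \<subset> {a \<in> I. g a \<noteq> 0}" using hg l by blast
        then have "card {a \<in> I. h a \<noteq> 0} < card {a \<in> I. g a \<noteq> 0}"
          using I by (intro psubset_card_mono) auto
        then show ?thesis using h_nonneg by (rule less.hyps)
      next
        case False
        then obtain l where l: "l \<in> I - {i, k}" "\<delta> = sum g I / 2 - g l"
          using \<delta>_in by (auto simp: S_def)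
        then have "sum h I \<le> 2 * h l" unfolding h_sum by (simp add: h_def)
        then show ?thesis using l by (intro symmetric_coupling_star[OF I h_nonneg, where i = l]) auto
      qed
      then obtain j where j: "symmetric_coupling I h j" by blast
      have row: "(\<Sum>b\<in>I. j a b) = h a" if "a \<in> I" for a
        using j that unfolding symmetric_coupling_def by blast
      define j' where "j' a b = j a b + (if (a, b) = (i, k) \<or> (a, b) = (k, i) then \<delta> else 0)" for a b
      have "(\<Sum>b\<in>I. j' a b) = g a" if "a \<in> I" for a
      proof -
        have "(\<Sum>b\<in>I. j' a b)
            = h a + (\<Sum>b\<in>I. if (a, b) = (i, k) \<or> (a, b) = (k, i) then \<delta> else 0)"
          using that by (simp add: j'_def sum.distrib row)
        also have "(\<Sum>b\<in>I. if (a, b) = (i, k) \<or> (a, b) = (k, i) then \<delta> else 0)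
            = (if a = i \<or> a = k then \<delta> else 0)"
        proof -
          consider "a = i" | "a = k" | "a \<noteq> i" "a \<noteq> k" by blast
          then show ?thesis using I i k by cases (auto simp: sum.delta)
        qed
        finally show ?thesis using k by (auto simp: h_def)
      qed
      \<comment> \<open>No entry exceeds half of the total, for \<open>g\<close> as for
        \<open>h\<close>, so both prescribed diagonals vanish; the added mass lies off the
        diagonal.\<close>
      moreover have "j' a a = max 0 (2 * g a - sum g I)" if "a \<in> I" for a
        using j that diag[OF that] small[OF that] k by (auto simp: j'_def symmetric_coupling_def)
      ultimately have "symmetric_coupling I g j'"
        using j \<delta>_pos by (auto simp: symmetric_coupling_def j'_def)
      then show ?thesis by blast
    qed
  qed
qed

text \<open>\<open>None\<close> receives the missing mass \<open>1 - sum x U\<close>, so the total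
  is 1 and the minimal diagonal takes the stated form. A small diagonal matters because a pair with
  equal entries has no proper second choice.\<close>

lemma symmetric_pair_pmf_exists:
  fixes x :: "'u \<Rightarrow> real"
  assumes U: "finite U" and x: "\<And>u. u \<in> U \<Longrightarrow> 0 \<le> x u" "sum x U \<le> 1"
  shows "\<exists>D :: ('u option \<times> 'u option) pmf.
    (\<forall>a b. pmf D (a, b) = pmf D (b, a)) \<and>
    (\<forall>u\<in>U. (\<Sum>b\<in>insert None (Some ` U). pmf D (Some u, b)) = x u) \<and>
    (\<forall>u\<in>U. pmf D (Some u, Some u) = max 0 (2 * x u - 1))"
proof -
  define I where "I = insert None (Some ` U)"
  define g where "g = case_option (1 - sum x U) x"
  have I: "finite I" using U by (simp add: I_def)
  have g: "0 \<le> g a" if "a \<in> I" for a using that x by (auto simp: I_def g_def)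
  have g_sum: "sum g I = 1" using U by (simp add: I_def g_def sum.reindex)
  have "\<exists>j. symmetric_coupling I g j" by (rule symmetric_coupling_exists[OF I g])
  then obtain j where j: "symmetric_coupling I g j" by blast
  have row: "(\<Sum>b\<in>I. j a b) = g a" if "a \<in> I" for a
    using j that unfolding symmetric_coupling_def by blast
  define f where "f = (\<lambda>(a, b). if a \<in> I \<and> b \<in> I then j a b else 0)"
  have f: "0 \<le> f z" for z using j by (auto simp: f_def symmetric_coupling_def split: prod.split)
  have "(\<integral>\<^sup>+ z. ennreal (f z) \<partial>count_space UNIV) = (\<Sum>z\<in>I \<times> I. ennreal (f z))"
    using I by (intro nn_integral_count_space') (auto simp: f_def split: if_splits)
  also have "\<dots> = ennreal (\<Sum>z\<in>I \<times> I. f z)" using f by (intro sum_ennreal) auto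
  also have "(\<Sum>z\<in>I \<times> I. f z) = (\<Sum>a\<in>I. \<Sum>b\<in>I. j a b)"
    by (simp add: sum.cartesian_product f_def) (intro sum.cong, auto)
  also have "\<dots> = 1" using g_sum by (simp add: row)
  finally have D: "pmf (embed_pmf f) z = f z" for z using f by (intro pmf_embed_pmf) auto
  have "pmf (embed_pmf f) (a, b) = pmf (embed_pmf f) (b, a)" for a b
    using j unfolding D by (auto simp: f_def symmetric_coupling_def)
  moreover have "(\<Sum>b\<in>I. pmf (embed_pmf f) (Some u, b)) = x u" if "u \<in> U" for u
  proof -
    have "Some u \<in> I" using that by (simp add: I_def)
    then show ?thesis unfolding D by (simp add: f_def row) (simp add: g_def)
  qed
  moreover have "pmf (embed_pmf f) (Some u, Some u) = max 0 (2 * x u - 1)" if "u \<in> U" for u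
  proof -
    have "Some u \<in> I" using that by (simp add: I_def)
    then show ?thesis using j g_sum unfolding D by (simp add: f_def symmetric_coupling_def) (simp add: g_def)
  qed
  ultimately show ?thesis unfolding I_def by blast
qed

section \<open>Match rates of the offline optimum\<close>

text \<open>The probability that the tree matches round \<open>t\<close> to \<open>u\<close>.\<close>

primrec success_prob :: "real \<Rightarrow> 'u offline_algorithm \<Rightarrow> nat \<Rightarrow> 'u \<Rightarrow> real" where
  "success_prob p Stop t u = 0"
| "success_prob p (Probe t' u' s f) t u =
     p * (of_bool (t = t' \<and> u = u') + success_prob p s t u) + (1 - p) * success_prob p f t u"

lemma success_prob_nonneg:
  assumes "0 \<le> p" "p \<le> 1"
  shows "0 \<le> success_prob p T t u"
  using assms by (induction T) auto

lemma success_prob_eq_0: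
  assumes "feasible E vs R S T" "t \<notin> R \<or> u \<notin> S \<or> (u, vs ! t) \<notin> E"
  shows "success_prob p T t u = 0"
  using assms by (induction T arbitrary: R S) auto

lemma sum_success_prob:
  assumes "finite R" "finite S" "feasible E vs R S T"
  shows "(\<Sum>t\<in>R. \<Sum>u\<in>S. success_prob p T t u) = expected_reward p T"
  using assms
proof (induction T arbitrary: R S)
  case (Probe t' u' s f)
  have s: "(\<Sum>t\<in>R. \<Sum>u\<in>S. success_prob p s t u) = expected_reward p s"
  proof -
    have "feasible E vs (R - {t'}) (S - {u'}) s" using Probe.prems by simp
    note eq0 = success_prob_eq_0[OF this, of _ _ p]
    have "(\<Sum>t\<in>R. \<Sum>u\<in>S. success_prob p s t u) = (\<Sum>t\<in>R - {t'}. \<Sum>u\<in>S - {u'}. success_prob p s t u)"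
      using Probe.prems(1,2) eq0
      by (intro sum.mono_neutral_cong_right) (auto intro!: sum.mono_neutral_right)
    then show ?thesis using Probe by simp
  qed
  have f: "(\<Sum>t\<in>R. \<Sum>u\<in>S. success_prob p f t u) = expected_reward p f"
  proof -
    have "feasible E vs (R - {t'}) S f" using Probe.prems by simp
    note eq0 = success_prob_eq_0[OF this, of _ _ p]
    have "(\<Sum>t\<in>R. \<Sum>u\<in>S. success_prob p f t u) = (\<Sum>t\<in>R - {t'}. \<Sum>u\<in>S. success_prob p f t u)"
      using Probe.prems(1,2) eq0 by (intro sum.mono_neutral_right) auto
    then show ?thesis using Probe by simp
  qed
  have "(\<Sum>t\<in>R. \<Sum>u\<in>S. of_bool (t = t' \<and> u = u')) = (1 :: real)"
  proof -
    have "(\<Sum>t\<in>R. \<Sum>u\<in>S. of_bool (t = t' \<and> u = u')) = (\<Sum>t\<in>R. of_bool (t = t') :: real)"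
      using Probe.prems by (intro sum.cong) (auto simp: of_bool_def sum.delta)
    also have "\<dots> = 1" using Probe.prems by (simp add: of_bool_def sum.delta)
    finally show ?thesis .
  qed
  then show ?case using s f
    by (simp add: sum.distrib flip: sum_distrib_left)
qed auto

text \<open>On every branch round \<open>t\<close> is probed at most once, and a probe succeeds with
  probability \<open>p\<close>.\<close>

lemma sum_success_prob_round_le:
  assumes p: "0 \<le> p" "p \<le> 1" and "finite S" "feasible E vs R S T"
  shows "(\<Sum>u\<in>S. success_prob p T t u) \<le> p"
  using assms(3,4)
proof (induction T arbitrary: R S)
  case Stop
  then show ?case using p by simp
next
  case (Probe t' u' s f)
  have fs: "feasible E vs (R - {t'}) (S - {u'}) s" and ff: "feasible E vs (R - {t'}) S f"
    using Probe.prems by auto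
  have split: "(\<Sum>u\<in>S. success_prob p (Probe t' u' s f) t u) =
      p * ((\<Sum>u\<in>S. of_bool (t = t' \<and> u = u')) + (\<Sum>u\<in>S. success_prob p s t u))
      + (1 - p) * (\<Sum>u\<in>S. success_prob p f t u)"
    by (simp add: sum.distrib distrib_left flip: sum_distrib_left)
  show ?case
  proof (cases "t = t'")
    case True
    have "(\<Sum>u\<in>S. success_prob p s t u) = 0" "(\<Sum>u\<in>S. success_prob p f t u) = 0"
      using success_prob_eq_0[OF fs] success_prob_eq_0[OF ff] True by (auto intro!: sum.neutral)
    then show ?thesis using True Probe.prems unfolding split by (simp add: of_bool_def sum.delta)
  next
    case False
    have "(\<Sum>u\<in>S. success_prob p s t u) = (\<Sum>u\<in>S - {u'}. success_prob p s t u)"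
      using Probe.prems success_prob_eq_0[OF fs] by (intro sum.mono_neutral_right) auto
    then have "(\<Sum>u\<in>S. success_prob p s t u) \<le> p" using Probe.IH(1)[OF _ fs] Probe.prems by simp
    moreover have "(\<Sum>u\<in>S. success_prob p f t u) \<le> p" using Probe.IH(2)[OF _ ff] Probe.prems by simp
    ultimately have "p * (\<Sum>u\<in>S. success_prob p s t u) + (1 - p) * (\<Sum>u\<in>S. success_prob p f t u)
        \<le> p * p + (1 - p) * p"
      using p by (intro add_mono mult_left_mono) auto
    then show ?thesis using False unfolding split by (simp add: algebra_simps)
  qed
qed

text \<open>
  The bound is the probability that at least one of \<open>card X\<close> independent coins succeeds: \<open>u\<close> can
  only be matched through \<open>X\<close> if some round in \<open>X\<close> would succeed with \<open>u\<close>.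
\<close>

lemma sum_success_prob_vertex_le:
  assumes p: "0 \<le> p" "p \<le> 1" and "finite X" "feasible E vs R S T"
  shows "(\<Sum>t\<in>X. success_prob p T t u) \<le> 1 - (1 - p) ^ card X"
  using assms(3,4)
proof (induction T arbitrary: R S X)
  case Stop
  then show ?case using p by (simp add: power_le_one)
next
  case (Probe t' u' s f)
  have fs: "feasible E vs (R - {t'}) (S - {u'}) s" and ff: "feasible E vs (R - {t'}) S f"
    using Probe.prems by auto
  have split: "(\<Sum>t\<in>X. success_prob p (Probe t' u' s f) t u) =
      p * ((\<Sum>t\<in>X. of_bool (t = t' \<and> u = u')) + (\<Sum>t\<in>X. success_prob p s t u))
      + (1 - p) * (\<Sum>t\<in>X. success_prob p f t u)"
    by (simp add: sum.distrib distrib_left flip: sum_distrib_left)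
  have IHs: "(\<Sum>t\<in>X. success_prob p s t u) \<le> 1 - (1 - p) ^ card X"
    and IHf: "(\<Sum>t\<in>X. success_prob p f t u) \<le> 1 - (1 - p) ^ card X"
    using Probe.IH(1)[OF _ fs] Probe.IH(2)[OF _ ff] Probe.prems by simp_all
  show ?case
  proof (cases "u = u' \<and> t' \<in> X")
    case True
    have s0: "(\<Sum>t\<in>X. success_prob p s t u) = 0"
      using success_prob_eq_0[OF fs] True by (auto intro!: sum.neutral)
    have one: "(\<Sum>t\<in>X. of_bool (t = t' \<and> u = u')) = (1 :: real)"
      using True Probe.prems by (simp add: of_bool_def sum.delta)
    have "(\<Sum>t\<in>X. success_prob p f t u) = (\<Sum>t\<in>X - {t'}. success_prob p f t u)"
      using Probe.prems success_prob_eq_0[OF ff] by (intro sum.mono_neutral_right) auto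
    also have "\<dots> \<le> 1 - (1 - p) ^ card (X - {t'})"
      using Probe.IH(2)[of "X - {t'}", OF _ ff] Probe.prems by simp
    finally have "(1 - p) * (\<Sum>t\<in>X. success_prob p f t u) \<le> (1 - p) * (1 - (1 - p) ^ card (X - {t'}))"
      using p by (intro mult_left_mono) auto
    also have "\<dots> = 1 - p - (1 - p) ^ Suc (card (X - {t'}))" by (simp add: algebra_simps)
    also have "Suc (card (X - {t'})) = card X"
      using True Probe.prems by (intro card_Suc_Diff1) auto
    finally show ?thesis unfolding split s0 one by simp
  next
    case False
    then have zero: "(\<Sum>t\<in>X. of_bool (t = t' \<and> u = u')) = (0 :: real)"
      by (intro sum.neutral) auto
    have "p * (\<Sum>t\<in>X. success_prob p s t u) + (1 - p) * (\<Sum>t\<in>X. success_prob p f t u)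
        \<le> p * (1 - (1 - p) ^ card X) + (1 - p) * (1 - (1 - p) ^ card X)"
      using p IHs IHf by (intro add_mono mult_left_mono) auto
    then show ?thesis unfolding split zero by (simp add: algebra_simps)
  qed
qed

text \<open>Each probe consumes a round, so the depth is at most \<open>card R\<close>, with
  finitely many labels. Hence the supremum in \<open>OPT\<close> is attained and an optimal tree can
  be fixed for every arrival sequence.\<close>

lemma finite_feasible:
  assumes "finite R" "finite S"
  shows "finite {T. feasible E vs R S T}"
  using assms
proof (induction "card R" arbitrary: R S)
  case 0
  have "T = Stop" if "feasible E vs R S T" for T using that 0 by (cases T) auto
  then have "{T. feasible E vs R S T} \<subseteq> {Stop}" by blast
  then show ?case by (rule finite_subset) simp
next
  case (Suc m)
  let ?F = "\<lambda>R S. {T. feasible E vs R S T}"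
  have "?F R S \<subseteq> {Stop} \<union> (\<Union>t\<in>R. \<Union>u\<in>S. case_prod (Probe t u) ` (?F (R - {t}) (S - {u}) \<times> ?F (R - {t}) S))"
  proof
    fix T assume "T \<in> ?F R S"
    then show "T \<in> {Stop} \<union> (\<Union>t\<in>R. \<Union>u\<in>S. case_prod (Probe t u) ` (?F (R - {t}) (S - {u}) \<times> ?F (R - {t}) S))"
      by (cases T) force+
  qed
  moreover have "finite (?F (R - {t}) S')" if "t \<in> R" "finite S'" for t S'
    using Suc that by (intro Suc.hyps) auto
  ultimately show ?case using Suc.prems by (elim finite_subset) auto
qed

lemma OPT_attained:
  assumes "finite (Offline G)"
  shows "\<exists>T. feasible (Edges G) vs {..<length vs} (Offline G) T \<and> expected_reward p T = OPT p G vs"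
proof -
  let ?F = "{T. feasible (Edges G) vs {..<length vs} (Offline G) T}"
  have "finite (expected_reward p ` ?F)" "expected_reward p ` ?F \<noteq> {}"
    using finite_feasible[OF _ assms] OPT_nonempty by auto
  then have "OPT p G vs \<in> expected_reward p ` ?F"
    unfolding OPT_def by (simp add: cSup_eq_Max Max_in)
  then show ?thesis by auto
qed

definition opt_tree :: "real \<Rightarrow> ('u, 'v) bigraph \<Rightarrow> 'v list \<Rightarrow> 'u offline_algorithm" where
  "opt_tree p G vs = (SOME T. feasible (Edges G) vs {..<length vs} (Offline G) T \<and>
     expected_reward p T = OPT p G vs)"

lemma opt_tree:
  assumes "finite (Offline G)"
  shows "feasible (Edges G) vs {..<length vs} (Offline G) (opt_tree p G vs)"
    and "expected_reward p (opt_tree p G vs) = OPT p G vs"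
  using someI_ex[OF OPT_attained[OF assms, of vs p]] by (auto simp: opt_tree_def)

abbreviation arrivals :: "('u, 'v) bigraph \<Rightarrow> 'v list pmf" where
  "arrivals G \<equiv> replicate_pmf (card (Online G)) (pmf_of_set (Online G))"

definition match_rate :: "real \<Rightarrow> ('u, 'v) bigraph \<Rightarrow> 'u \<Rightarrow> 'v \<Rightarrow> real" where
  "match_rate p G u v = measure_pmf.expectation (arrivals G)
     (\<lambda>vs. \<Sum>t | t < length vs \<and> vs ! t = v. success_prob p (opt_tree p G vs) t u)"

section \<open>Expectations over independent uniform arrivals\<close>

lemma finite_set_replicate_pmf:
  assumes "finite (set_pmf M)"
  shows "finite (set_pmf (replicate_pmf m M))"
proof -
  have "{xs \<in> lists (set_pmf M). length xs = m} = {xs. set xs \<subseteq> set_pmf M \<and> length xs = m}" by auto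
  then show ?thesis using finite_lists_length_eq[OF assms] by (simp add: set_replicate_pmf)
qed

lemma expectation_replicate_pmf_Suc:
  fixes f :: "'a list \<Rightarrow> real"
  assumes "finite (set_pmf M)"
  shows "measure_pmf.expectation (replicate_pmf (Suc m) M) f =
    measure_pmf.expectation M (\<lambda>x. measure_pmf.expectation (replicate_pmf m M) (\<lambda>xs. f (x # xs)))"
proof -
  have "replicate_pmf (Suc m) M = bind_pmf M (\<lambda>x. map_pmf (\<lambda>xs. x # xs) (replicate_pmf m M))"
    by (simp add: map_pmf_def)
  then show ?thesis
    using assms finite_set_replicate_pmf[OF assms, of m]
    by (simp only:) (subst pmf_expectation_bind[where A = "set_pmf M"],
        auto simp: integral_measure_pmf_real[of "set_pmf M"] mult.commute)
qed

text \<open>Each arrival independently contributes a factor \<open>c\<close> with probability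
  \<open>card S / card V\<close> and 1 otherwise. With \<open>c = 1 - p\<close> this is the
  probability that no arrival in \<open>S\<close> would succeed.\<close>

lemma expectation_power_hits:
  fixes c :: real
  assumes V: "finite V" "V \<noteq> {}" and S: "S \<subseteq> V"
  shows "measure_pmf.expectation (replicate_pmf m (pmf_of_set V)) (\<lambda>vs. c ^ length (filter (\<lambda>v. v \<in> S) vs))
    = (1 - (1 - c) * card S / card V) ^ m"
proof (induction m)
  case (Suc m)
  let ?e = "measure_pmf.expectation (replicate_pmf m (pmf_of_set V)) (\<lambda>vs. c ^ length (filter (\<lambda>v. v \<in> S) vs))"
  have "measure_pmf.expectation (replicate_pmf (Suc m) (pmf_of_set V)) (\<lambda>vs. c ^ length (filter (\<lambda>v. v \<in> S) vs))
      = (\<Sum>v\<in>V. (if v \<in> S then c * ?e else ?e)) / card V"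
  proof -
    have "measure_pmf.expectation (replicate_pmf m (pmf_of_set V)) (\<lambda>vs. c ^ length (filter (\<lambda>v. v \<in> S) (v # vs)))
      = (if v \<in> S then c * ?e else ?e)" for v
      by (cases "v \<in> S") simp_all
    then show ?thesis
      using V by (subst expectation_replicate_pmf_Suc) (simp_all add: integral_pmf_of_set)
  qed
  also have "(\<Sum>v\<in>V. (if v \<in> S then c * ?e else ?e)) = card S * (c * ?e) + (card V - card S) * ?e"
    using V S by (simp add: sum.If_cases card_Diff_subset finite_subset Int_absorb1 flip: Diff_eq)
  also have "\<dots> / card V = (1 - (1 - c) * card S / card V) * ?e"
    using V S card_mono[OF V(1) S] by (simp add: field_simps of_nat_diff)
  finally show ?case using Suc by simp
qed simp

lemma expectation_hits:
  assumes V: "finite V" "V \<noteq> {}" and S: "S \<subseteq> V"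
  shows "measure_pmf.expectation (replicate_pmf m (pmf_of_set V)) (\<lambda>vs. real (length (filter (\<lambda>v. v \<in> S) vs)))
    = m * card S / card V"
proof (induction m)
  case (Suc m)
  have fin: "finite (set_pmf (replicate_pmf m (pmf_of_set V)))"
    using V by (intro finite_set_replicate_pmf) simp
  let ?e = "measure_pmf.expectation (replicate_pmf m (pmf_of_set V)) (\<lambda>vs. real (length (filter (\<lambda>v. v \<in> S) vs)))"
  have "measure_pmf.expectation (replicate_pmf (Suc m) (pmf_of_set V)) (\<lambda>vs. real (length (filter (\<lambda>v. v \<in> S) vs)))
      = (\<Sum>v\<in>V. of_bool (v \<in> S) + ?e) / card V"
  proof -
    have "measure_pmf.expectation (replicate_pmf m (pmf_of_set V)) (\<lambda>vs. real (length (filter (\<lambda>v. v \<in> S) (v # vs))))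
      = of_bool (v \<in> S) + ?e" for v
      using fin by (cases "v \<in> S") (simp_all add: integrable_measure_pmf_finite)
    then show ?thesis
      using V by (subst expectation_replicate_pmf_Suc) (simp_all add: integral_pmf_of_set)
  qed
  also have "(\<Sum>v\<in>V. of_bool (v \<in> S) + ?e) = card S + card V * ?e"
    using V S by (simp add: sum.distrib Int_absorb1)
  also have "\<dots> / card V = Suc m * card S / card V"
    using V Suc by (simp add: field_simps card_gt_0_iff)
  finally show ?case .
qed simp

section \<open>Linear constraints on the match rates\<close>

context
  fixes p :: real and G :: "('u, 'v) bigraph"
  assumes p: "0 \<le> p" "p \<le> 1" and bip: "bipartite_graph G" and ne: "Online G \<noteq> {}"
begin

lemma finite_sides: "finite (Offline G)" "finite (Online G)"
  using bip by (auto simp: bipartite_graph_def)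

lemma finite_arrivals: "finite (set_pmf (arrivals G))"
  using finite_sides ne by (intro finite_set_replicate_pmf) simp

lemma integrable_arrivals [simp]: "integrable (arrivals G) (f :: _ \<Rightarrow> real)"
  using finite_arrivals by (rule integrable_measure_pmf_finite)

lemma set_arrivals:
  assumes "vs \<in> set_pmf (arrivals G)"
  shows "set vs \<subseteq> Online G" "length vs = card (Online G)"
  using assms finite_sides ne by (auto simp: set_replicate_pmf)

lemma match_rate_nonneg: "0 \<le> match_rate p G u v"
  unfolding match_rate_def using p
  by (intro Bochner_Integration.integral_nonneg sum_nonneg success_prob_nonneg) auto

lemma match_rate_non_edge:
  assumes "(u, v) \<notin> Edges G"
  shows "match_rate p G u v = 0"
proof -
  have "(\<Sum>t | t < length vs \<and> vs ! t = v. success_prob p (opt_tree p G vs) t u) = 0" for vs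
    using success_prob_eq_0[OF opt_tree(1)[OF finite_sides(1), of vs p], of _ u p] assms
    by (intro sum.neutral) auto
  then show ?thesis by (simp add: match_rate_def)
qed

text \<open>The per-round bound \<open>p\<close> is multiplied by the expected number of arrivals of
  type \<open>v\<close>, which is 1 because there are as many rounds as types.\<close>

lemma sum_match_rate_type_le:
  assumes "v \<in> Online G"
  shows "(\<Sum>u\<in>Offline G. match_rate p G u v) \<le> p"
proof -
  have "(\<Sum>u\<in>Offline G. match_rate p G u v) = measure_pmf.expectation (arrivals G)
      (\<lambda>vs. \<Sum>u\<in>Offline G. \<Sum>t | t < length vs \<and> vs ! t = v. success_prob p (opt_tree p G vs) t u)"
    unfolding match_rate_def by (rule Bochner_Integration.integral_sum[symmetric]) simp
  also have "\<dots> \<le> measure_pmf.expectation (arrivals G)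
      (\<lambda>vs. p * real (length (filter (\<lambda>w. w \<in> {v}) vs)))"
  proof (rule integral_mono)
    fix vs :: "'v list"
    have "(\<Sum>u\<in>Offline G. \<Sum>t | t < length vs \<and> vs ! t = v. success_prob p (opt_tree p G vs) t u)
        = (\<Sum>t | t < length vs \<and> vs ! t = v. \<Sum>u\<in>Offline G. success_prob p (opt_tree p G vs) t u)"
      by (rule sum.swap)
    also have "\<dots> \<le> (\<Sum>t | t < length vs \<and> vs ! t = v. p)"
      by (intro sum_mono sum_success_prob_round_le[OF p finite_sides(1) opt_tree(1)[OF finite_sides(1)]])
    also have "\<dots> = p * real (length (filter (\<lambda>w. w \<in> {v}) vs))"
      by (simp add: length_filter_conv_card)
    finally show "(\<Sum>u\<in>Offline G. \<Sum>t | t < length vs \<and> vs ! t = v. success_prob p (opt_tree p G vs) t u)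
      \<le> p * real (length (filter (\<lambda>w. w \<in> {v}) vs))" .
  qed simp_all
  also have "\<dots> = p"
    using expectation_hits[of "Online G" "{v}" "card (Online G)"] finite_sides ne assms by simp
  finally show ?thesis .
qed

text \<open>With the arrivals fixed, the coin bound applies to the rounds whose type lies in
  \<open>S\<close>; it is then averaged over their number. Taking all types gives
  \<open>y u \<le> 1\<close>, smaller sets bound the diagonal of the pairs.\<close>

lemma sum_match_rate_vertex_le:
  assumes "S \<subseteq> Online G"
  shows "(\<Sum>v\<in>S. match_rate p G u v) \<le> 1 - (1 - p * card S / card (Online G)) ^ card (Online G)"
proof -
  have S: "finite S" using assms finite_sides finite_subset by blast
  have "(\<Sum>v\<in>S. match_rate p G u v) = measure_pmf.expectation (arrivals G)
      (\<lambda>vs. \<Sum>v\<in>S. \<Sum>t | t < length vs \<and> vs ! t = v. success_prob p (opt_tree p G vs) t u)"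
    unfolding match_rate_def by (rule Bochner_Integration.integral_sum[symmetric]) simp
  also have "\<dots> \<le> measure_pmf.expectation (arrivals G)
      (\<lambda>vs. 1 - (1 - p) ^ length (filter (\<lambda>v. v \<in> S) vs))"
  proof (rule integral_mono)
    fix vs :: "'v list"
    define X where "X = {t. t < length vs \<and> vs ! t \<in> S}"
    have "(\<Sum>v\<in>S. \<Sum>t | t < length vs \<and> vs ! t = v. success_prob p (opt_tree p G vs) t u)
        = (\<Sum>v\<in>S. \<Sum>t | t \<in> X \<and> vs ! t = v. success_prob p (opt_tree p G vs) t u)"
      by (intro sum.cong refl) (auto simp: X_def)
    also have "\<dots> = (\<Sum>t\<in>X. success_prob p (opt_tree p G vs) t u)"
      using S by (intro sum.group) (auto simp: X_def)
    also have "\<dots> \<le> 1 - (1 - p) ^ card X"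
      using p opt_tree(1)[OF finite_sides(1)] by (intro sum_success_prob_vertex_le) (auto simp: X_def)
    finally show "(\<Sum>v\<in>S. \<Sum>t | t < length vs \<and> vs ! t = v. success_prob p (opt_tree p G vs) t u)
      \<le> 1 - (1 - p) ^ length (filter (\<lambda>v. v \<in> S) vs)"
      by (simp add: X_def length_filter_conv_card)
  qed simp_all
  also have "\<dots> = 1 - (1 - p * card S / card (Online G)) ^ card (Online G)"
    using expectation_power_hits[of "Online G" S "card (Online G)" "1 - p"] finite_sides ne assms by simp
  finally show ?thesis .
qed

lemma sum_match_rate: "(\<Sum>u\<in>Offline G. \<Sum>v\<in>Online G. match_rate p G u v) = expected_OPT p G"
proof -
  have "(\<Sum>u\<in>Offline G. \<Sum>v\<in>Online G. match_rate p G u v) = measure_pmf.expectation (arrivals G)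
      (\<lambda>vs. \<Sum>u\<in>Offline G. \<Sum>v\<in>Online G.
        \<Sum>t | t < length vs \<and> vs ! t = v. success_prob p (opt_tree p G vs) t u)"
    unfolding match_rate_def by (simp add: Bochner_Integration.integral_sum)
  also have "\<dots> = measure_pmf.expectation (arrivals G) (OPT p G)"
  proof (intro integral_cong_AE)
    \<comment> \<open>Grouping the rounds by type keeps every round only if all arrivals lie in
      \<open>Online G\<close>, which holds on the support.\<close>
    show "AE vs in arrivals G. (\<Sum>u\<in>Offline G. \<Sum>v\<in>Online G.
        \<Sum>t | t < length vs \<and> vs ! t = v. success_prob p (opt_tree p G vs) t u) = OPT p G vs"
    proof (rule AE_pmfI)
      fix vs assume vs: "vs \<in> set_pmf (arrivals G)"
      have "(\<Sum>u\<in>Offline G. \<Sum>v\<in>Online G.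
          \<Sum>t | t < length vs \<and> vs ! t = v. success_prob p (opt_tree p G vs) t u)
        = (\<Sum>u\<in>Offline G. \<Sum>t<length vs. success_prob p (opt_tree p G vs) t u)"
      proof (rule sum.cong)
        fix u
        have "(\<Sum>v\<in>Online G. \<Sum>t | t \<in> {..<length vs} \<and> vs ! t = v. success_prob p (opt_tree p G vs) t u)
          = (\<Sum>t<length vs. success_prob p (opt_tree p G vs) t u)"
          using set_arrivals(1)[OF vs] finite_sides by (intro sum.group) (auto simp: subset_iff)
        then show "(\<Sum>v\<in>Online G. \<Sum>t | t < length vs \<and> vs ! t = v. success_prob p (opt_tree p G vs) t u)
          = (\<Sum>t<length vs. success_prob p (opt_tree p G vs) t u)" by simp
      qed simp
      also have "\<dots> = (\<Sum>t<length vs. \<Sum>u\<in>Offline G. success_prob p (opt_tree p G vs) t u)"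
        by (rule sum.swap)
      also have "\<dots> = OPT p G vs"
        using sum_success_prob[OF _ finite_sides(1) opt_tree(1)[OF finite_sides(1)], of vs p]
          opt_tree(2)[OF finite_sides(1)] by simp
      finally show "(\<Sum>u\<in>Offline G. \<Sum>v\<in>Online G.
          \<Sum>t | t < length vs \<and> vs ! t = v. success_prob p (opt_tree p G vs) t u) = OPT p G vs" .
    qed
  qed simp_all
  finally show ?thesis by (simp add: expected_OPT_def)
qed

lemma expected_OPT_pos:
  assumes "0 < p" "Edges G \<noteq> {}"
  shows "0 < expected_OPT p G"
proof -
  obtain u v where uv: "(u, v) \<in> Edges G" using assms by auto
  have u: "u \<in> Offline G" and v: "v \<in> Online G" using uv bip by (auto simp: bipartite_graph_def)
  have le_OPT: "expected_reward p T \<le> OPT p G vs"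
    if "feasible (Edges G) vs {..<length vs} (Offline G) T" for T vs
    unfolding OPT_def using that p by (intro cSUP_upper OPT_bdd_above) auto
  have OPT_nonneg: "0 \<le> OPT p G vs" for vs using le_OPT[of vs Stop] by simp
  \<comment> \<open>A sequence of positive probability on which a single probe of the edge already
    earns \<open>p\<close>.\<close>
  let ?vs = "replicate (card (Online G)) v"
  have card: "0 < card (Online G)" using finite_sides ne by (simp add: card_gt_0_iff)
  have mem: "?vs \<in> set_pmf (arrivals G)"
    using finite_sides ne v by (auto simp: set_replicate_pmf)
  have "p \<le> OPT p G ?vs"
    using le_OPT[of ?vs "Probe 0 u Stop Stop"] uv u card by simp
  then have "0 < OPT p G ?vs * pmf (arrivals G) ?vs" using assms mem by (simp add: pmf_positive)
  then have "0 < (\<Sum>vs\<in>set_pmf (arrivals G). OPT p G vs * pmf (arrivals G) vs)"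
    using finite_arrivals mem OPT_nonneg by (intro sum_pos2) auto
  also have "\<dots> = expected_OPT p G"
    unfolding expected_OPT_def using finite_arrivals by (intro integral_measure_pmf_real[symmetric]) auto
  finally show ?thesis .
qed

end

section \<open>Availability under an online algorithm\<close>

lemma expectation_bind_pmf:
  fixes f :: "'a \<Rightarrow> real"
  assumes "\<And>x. \<bar>f x\<bar> \<le> B"
  shows "measure_pmf.expectation (bind_pmf M N) f
    = measure_pmf.expectation M (\<lambda>x. measure_pmf.expectation (N x) f)"
proof -
  have "measure_pmf.expectation (bind_pmf M N) f = integral\<^sup>L (measure_pmf M \<bind> (\<lambda>x. measure_pmf (N x))) f"
    by (simp add: measure_pmf_bind)
  also have "\<dots> = measure_pmf.expectation M (\<lambda>x. measure_pmf.expectation (N x) f)"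
    using assms
    by (intro integral_bind[where K = "count_space UNIV" and B = B and B' = 1])
       (auto simp: measure_pmf_in_subprob_algebra intro: measure_pmf.finite_measure_axioms)
  finally show ?thesis .
qed

lemma integrable_pmf_bounded:
  fixes f :: "'a \<Rightarrow> real"
  assumes "\<And>x. \<bar>f x\<bar> \<le> B"
  shows "integrable (measure_pmf M) f"
  using assms by (intro measure_pmf.integrable_const_bound[where B = B]) auto

lemma matched_append: "matched (h @ [(v, a, e)]) = matched h \<union> (if e then set_option a else {})"
  by (auto simp: matched_def)

lemma finite_matched: "finite (matched h)"
proof -
  have "matched h \<subseteq> (\<Union>(v, a, e)\<in>set h. set_option a)" by (auto simp: matched_def)
  then show ?thesis by (rule finite_subset) auto
qed

abbreviation avoids :: "'u set \<Rightarrow> ('u, 'v) history \<Rightarrow> real" where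
  "avoids W h \<equiv> of_bool (W \<inter> matched h = {})"

lemma expectation_online_round_avoids:
  assumes p: "0 \<le> p" "p \<le> 1" and V: "finite (Online G)" "Online G \<noteq> {}"
  shows "measure_pmf.expectation (online_round p A G h) (avoids W) =
    avoids W h * (1 - p * (\<Sum>v\<in>Online G. measure (A G h v) (Some ` W)) / card (Online G))"
proof -
  have assigned: "measure_pmf.expectation
      (bind_pmf (case a of None \<Rightarrow> return_pmf False | Some u \<Rightarrow> bernoulli_pmf p)
        (\<lambda>e. return_pmf (h @ [(v, a, e)]))) (avoids W)
      = avoids W h * (1 - p * indicator (Some ` W) a)" for v a
    using p by (subst expectation_bind_pmf[where B = 1])
      (auto simp: matched_append indicator_def split: option.split)
  have each: "measure_pmf.expectation (A G h v) (\<lambda>a. avoids W h * (1 - p * indicator (Some ` W) a))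
      = avoids W h * (1 - p * measure (A G h v) (Some ` W))" for v
  proof -
    have "integrable (A G h v) (indicator (Some ` W) :: _ \<Rightarrow> real)"
      by (rule integrable_pmf_bounded[where B = 1]) (simp add: indicator_def)
    then show ?thesis by (simp add: measure_pmf.prob_space)
  qed
  have bind: "measure_pmf.expectation (bind_pmf M N) (avoids W)
      = measure_pmf.expectation M (\<lambda>x. measure_pmf.expectation (N x) (avoids W))" for M N
    by (rule expectation_bind_pmf[where B = 1]) simp
  have "measure_pmf.expectation (online_round p A G h) (avoids W)
      = measure_pmf.expectation (pmf_of_set (Online G)) (\<lambda>v. measure_pmf.expectation (A G h v)
          (\<lambda>a. avoids W h * (1 - p * indicator (Some ` W) a)))"
    unfolding online_round_def bind[of "pmf_of_set (Online G)"]
    by (intro Bochner_Integration.integral_cong refl) (subst bind, simp only: assigned)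
  also have "\<dots> = (\<Sum>v\<in>Online G. measure_pmf.expectation (A G h v)
          (\<lambda>a. avoids W h * (1 - p * indicator (Some ` W) a))) / card (Online G)"
    using V by (simp add: integral_pmf_of_set)
  also have "\<dots> = (\<Sum>v\<in>Online G. avoids W h * (1 - p * measure (A G h v) (Some ` W))) / card (Online G)"
    by (simp only: each)
  also have "\<dots> = avoids W h * (1 - p * (\<Sum>v\<in>Online G. measure (A G h v) (Some ` W)) / card (Online G))"
    using V by (simp add: sum_subtractf field_simps flip: sum_distrib_left)
  finally show ?thesis .
qed

text \<open>The integrand is the expectation of an indicator after one more round and so lies in
  [0, 1], whatever \<open>A\<close> is.\<close>

lemma integrable_avoids_step:
  fixes A :: "('u, 'v) online_algorithm"
  assumes "0 \<le> p" "p \<le> 1" and "finite (Online G)" "Online G \<noteq> {}"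
  shows "integrable (measure_pmf M) (\<lambda>h. avoids W h *
    (1 - p * (\<Sum>v\<in>Online G. measure (A G h v) (Some ` W)) / card (Online G)))"
  unfolding expectation_online_round_avoids[OF assms, symmetric]
proof (rule integrable_pmf_bounded)
  fix h
  have "0 \<le> measure_pmf.expectation (online_round p A G h) (avoids W)"
    "measure_pmf.expectation (online_round p A G h) (avoids W) \<le> 1"
    by (auto intro!: measure_pmf.integral_le_const integrable_pmf_bounded[where B = 1])
  then show "\<bar>measure_pmf.expectation (online_round p A G h) (avoids W)\<bar> \<le> 1" by simp
qed

definition avoid_prob ::
  "real \<Rightarrow> ('u, 'v) online_algorithm \<Rightarrow> ('u, 'v) bigraph \<Rightarrow> 'u set \<Rightarrow> nat \<Rightarrow> real" where
  "avoid_prob p A G W k = measure_pmf.expectation (online_run p A G k) (avoids W)"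

lemma avoid_prob_0 [simp]: "avoid_prob p A G W 0 = 1"
  by (simp add: avoid_prob_def matched_def)

lemma avoid_prob_nonneg: "0 \<le> avoid_prob p A G W k"
  by (simp add: avoid_prob_def)

lemma avoid_prob_antimono:
  assumes "W \<subseteq> W'"
  shows "avoid_prob p A G W' k \<le> avoid_prob p A G W k"
  unfolding avoid_prob_def using assms
  by (intro integral_mono integrable_pmf_bounded[where B = 1]) auto

lemma avoid_prob_Suc:
  assumes "0 \<le> p" "p \<le> 1" and "finite (Online G)" "Online G \<noteq> {}"
  shows "avoid_prob p A G W (Suc k) = measure_pmf.expectation (online_run p A G k)
    (\<lambda>h. avoids W h * (1 - p * (\<Sum>v\<in>Online G. measure (A G h v) (Some ` W)) / card (Online G)))"
  unfolding avoid_prob_def using assms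
  by (simp add: expectation_bind_pmf[where B = 1] expectation_online_round_avoids)

text \<open>Only an inequality, since an arbitrary \<open>A\<close> may also match vertices outside
  \<open>Offline G\<close>.\<close>

lemma sum_unmatched_le_expected_ALG:
  assumes "finite (Offline G)"
  shows "(\<Sum>u\<in>Offline G. 1 - avoid_prob p A G {u} (card (Online G))) \<le> expected_ALG p A G"
proof -
  let ?M = "online_run p A G (card (Online G))"
  have "(\<Sum>u\<in>Offline G. 1 - avoid_prob p A G {u} (card (Online G)))
      = measure_pmf.expectation ?M (\<lambda>h. \<Sum>u\<in>Offline G. 1 - avoids {u} h)"
    by (simp add: avoid_prob_def integrable_pmf_bounded[where B = 1] Bochner_Integration.integral_sum
        measure_pmf.prob_space)
  also have "\<dots> \<le> measure_pmf.expectation ?M (\<lambda>h. real (card (matched h)))"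
  proof (rule integral_mono_AE)
    have len: "length h = k" if "h \<in> set_pmf (online_run p A G k)" for h k
      using that by (induction k arbitrary: h) (auto simp: online_round_def)
    have bound: "card (matched h) \<le> length h" for h :: "('a, 'b) history"
    proof -
      have "matched h \<subseteq> (\<lambda>z. the (fst (snd z))) ` set h" by (force simp: matched_def)
      then have "card (matched h) \<le> card (set h)" by (intro surj_card_le) auto
      then show ?thesis using card_length[of h] by linarith
    qed
    show "integrable ?M (\<lambda>h. real (card (matched h)))"
    proof (rule measure_pmf.integrable_const_bound[where B = "card (Online G)"])
      show "AE h in ?M. norm (real (card (matched h))) \<le> card (Online G)"
      proof (rule AE_pmfI)
        fix h assume "h \<in> set_pmf ?M"
        then show "norm (real (card (matched h))) \<le> card (Online G)"
          using bound[of h] len[of h] by simp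
      qed
    qed simp
    show "integrable ?M (\<lambda>h. \<Sum>u\<in>Offline G. 1 - avoids {u} h)"
      by (simp add: integrable_pmf_bounded[where B = 1])
    show "AE h in ?M. (\<Sum>u\<in>Offline G. 1 - avoids {u} h) \<le> real (card (matched h))"
    proof (rule AE_pmfI)
      fix h :: "('a, 'b) history"
      have "(\<Sum>u\<in>Offline G. 1 - avoids {u} h) = (\<Sum>u\<in>Offline G. of_bool (u \<in> matched h) :: real)"
        by (intro sum.cong) auto
      also have "\<dots> = card (Offline G \<inter> matched h)" using assms by simp
      also have "\<dots> \<le> real (card (matched h))"
        using finite_matched[of h] by (auto intro: card_mono)
      finally show "(\<Sum>u\<in>Offline G. 1 - avoids {u} h) \<le> real (card (matched h))" .
    qed
  qed
  finally show ?thesis by (simp add: expected_ALG_def)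
qed

section \<open>The two-choice algorithm\<close>

definition usable :: "('u, 'v) bigraph \<Rightarrow> ('u, 'v) history \<Rightarrow> 'v \<Rightarrow> 'u option \<Rightarrow> bool" where
  "usable G h v a \<longleftrightarrow> (\<exists>u \<in> Offline G - matched h. a = Some u \<and> (u, v) \<in> Edges G)"

text \<open>The law of the pair depends on the graph and the type only; the history enters through
  \<open>usable\<close>. As both choices are checked, the algorithm is admissible for every
  \<open>D\<close>.\<close>

definition two_choice ::
  "(('u, 'v) bigraph \<Rightarrow> 'v \<Rightarrow> ('u option \<times> 'u option) pmf) \<Rightarrow> ('u, 'v) online_algorithm" where
  "two_choice D G h v = map_pmf
     (\<lambda>(a, b). if usable G h v a then a else if usable G h v b then b else None) (D G v)"

lemma admissible_two_choice: "admissible (two_choice D)"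
  by (auto simp: admissible_def two_choice_def usable_def split: if_splits)

text \<open>\<open>x u v\<close> will be \<open>match_rate p G u v / p\<close>. Two rounds or more
  keep \<open>1 - (y u + y w) / n\<close> nonnegative, as each rate is at most 1.\<close>

locale two_choice_instance =
  fixes p :: real and G :: "('u, 'v) bigraph"
    and D :: "('u, 'v) bigraph \<Rightarrow> 'v \<Rightarrow> ('u option \<times> 'u option) pmf"
    and x :: "'u \<Rightarrow> 'v \<Rightarrow> real"
  assumes p: "0 \<le> p" "p \<le> 1" and bip: "bipartite_graph G" and two_le: "2 \<le> card (Online G)"
    and D_sym: "\<And>v a b. v \<in> Online G \<Longrightarrow> pmf (D G v) (a, b) = pmf (D G v) (b, a)"
    and D_row: "\<And>u v. u \<in> Offline G \<Longrightarrow> v \<in> Online G \<Longrightarrow>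
      (\<Sum>b\<in>insert None (Some ` Offline G). pmf (D G v) (Some u, b)) = x u v"
    and D_diag: "\<And>u v. u \<in> Offline G \<Longrightarrow> v \<in> Online G \<Longrightarrow>
      pmf (D G v) (Some u, Some u) = max 0 (2 * x u v - 1)"
    and x_non_edge: "\<And>u v. u \<in> Offline G \<Longrightarrow> v \<in> Online G \<Longrightarrow> (u, v) \<notin> Edges G \<Longrightarrow> x u v = 0"
    and rate_le: "\<And>u. u \<in> Offline G \<Longrightarrow> p * (\<Sum>v\<in>Online G. x u v) \<le> 1"
begin

abbreviation "n \<equiv> card (Online G)"
abbreviation "I \<equiv> insert None (Some ` Offline G)"
abbreviation "P \<equiv> avoid_prob p (two_choice D) G"

text \<open>
  The numbers \<open>y u\<close>, \<open>s w u\<close> and \<open>S u\<close> are \<open>n\<close> times the probability per round that an arrival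
  would be a success with first choice \<open>u\<close>, with choices \<open>(w, u)\<close>, and with \<open>u\<close> only as second
  choice, respectively. The option \<open>None\<close> behaves like an offline vertex that is matched from the start.
\<close>

definition y :: "'u \<Rightarrow> real" where
  "y u = p * (\<Sum>v\<in>Online G. x u v)"

definition s :: "'u option \<Rightarrow> 'u \<Rightarrow> real" where
  "s w u = p * (\<Sum>v\<in>Online G. pmf (D G v) (w, Some u))"

definition S :: "'u \<Rightarrow> real" where
  "S u = (\<Sum>w\<in>I - {Some u}. s w u)"

definition gone :: "('u, 'v) history \<Rightarrow> 'u option \<Rightarrow> bool" where
  "gone h w \<longleftrightarrow> (\<forall>u. w = Some u \<longrightarrow> u \<in> matched h)"

lemma fin: "finite (Offline G)" "finite (Online G)" "Online G \<noteq> {}"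
  using bip two_le by (auto simp: bipartite_graph_def)

lemma x_nonneg: "u \<in> Offline G \<Longrightarrow> v \<in> Online G \<Longrightarrow> 0 \<le> x u v"
  unfolding D_row[symmetric] by (intro sum_nonneg) simp

lemma y01: "u \<in> Offline G \<Longrightarrow> 0 \<le> y u" "u \<in> Offline G \<Longrightarrow> y u \<le> 1"
  using p rate_le x_nonneg by (auto simp: y_def intro!: mult_nonneg_nonneg sum_nonneg)

lemma s_nonneg: "0 \<le> s w u"
  using p by (auto simp: s_def intro!: mult_nonneg_nonneg sum_nonneg)

lemma s_commute: "s (Some w) u = s (Some u) w"
  by (simp add: s_def D_sym)

lemma D_column:
  assumes "u \<in> Offline G" "v \<in> Online G"
  shows "(\<Sum>w\<in>I - {Some u}. pmf (D G v) (w, Some u)) = x u v - max 0 (2 * x u v - 1)"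
proof -
  have "(\<Sum>w\<in>I - {Some u}. pmf (D G v) (w, Some u)) = (\<Sum>w\<in>I - {Some u}. pmf (D G v) (Some u, w))"
    using assms by (simp add: D_sym)
  also have "\<dots> = (\<Sum>w\<in>I. pmf (D G v) (Some u, w)) - pmf (D G v) (Some u, Some u)"
    using fin assms by (subst sum_diff1) auto
  finally show ?thesis using D_row[OF assms] D_diag[OF assms] by simp
qed

text \<open>The rate lost to equal pairs, in the form \<open>max 0 (2 * f - p)\<close> with
  \<open>f = p * x u v\<close> that the bound on sets of types controls.\<close>

lemma S_eq:
  assumes "u \<in> Offline G"
  shows "S u = y u - (\<Sum>v\<in>Online G. max 0 (2 * (p * x u v) - p))"
proof -
  have "S u = p * (\<Sum>v\<in>Online G. \<Sum>w\<in>I - {Some u}. pmf (D G v) (w, Some u))"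
    unfolding S_def s_def sum_distrib_left[symmetric] by (subst sum.swap) simp
  also have "\<dots> = p * (\<Sum>v\<in>Online G. x u v - max 0 (2 * x u v - 1))"
    using D_column[OF assms] by simp
  also have "\<dots> = y u - (\<Sum>v\<in>Online G. p * max 0 (2 * x u v - 1))"
    by (simp add: y_def sum_subtractf right_diff_distrib sum_distrib_left)
  also have "(\<Sum>v\<in>Online G. p * max 0 (2 * x u v - 1)) = (\<Sum>v\<in>Online G. max 0 (2 * (p * x u v) - p))"
    using p by (intro sum.cong refl) (simp add: max_mult_distrib_left algebra_simps)
  finally show ?thesis .
qed

lemma S_nonneg: "0 \<le> S u"
  using s_nonneg by (auto simp: S_def intro!: sum_nonneg)

lemma S_le: "u \<in> Offline G \<Longrightarrow> S u \<le> y u"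
  by (simp add: S_eq sum_nonneg)

text \<open>On an edge, drawing \<open>u\<close> first and drawing \<open>u\<close> second behind a
  first choice that is gone are disjoint events, and each leads to a probe of \<open>u\<close>. On a
  non-edge the left-hand side is 0.\<close>

lemma probe_prob_ge:
  assumes u: "u \<in> Offline G" "u \<notin> matched h" and v: "v \<in> Online G"
  shows "x u v + (\<Sum>w\<in>I - {Some u}. of_bool (gone h w) * pmf (D G v) (w, Some u))
    \<le> measure (two_choice D G h v) {Some u}"
proof (cases "(u, v) \<in> Edges G")
  case True
  have ok: "usable G h v (Some u)" using True u by (simp add: usable_def)
  define K where "K = {w \<in> I - {Some u}. gone h w}"
  have K: "finite K" using fin by (simp add: K_def)
  have "(\<Sum>w\<in>I - {Some u}. of_bool (gone h w) * pmf (D G v) (w, Some u)) = (\<Sum>w\<in>K. pmf (D G v) (w, Some u))"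
    unfolding K_def using fin by (simp add: sum.inter_filter flip: sum.inter_restrict)
      (intro sum.cong, auto)
  moreover have "sum (pmf (D G v)) ({a} \<times> B) = (\<Sum>b\<in>B. pmf (D G v) (a, b))" for a B
    using sum.cartesian_product[of "\<lambda>a b. pmf (D G v) (a, b)" B "{a}"] by simp
  moreover have "sum (pmf (D G v)) (B \<times> {b}) = (\<Sum>a\<in>B. pmf (D G v) (a, b))" for b B
    using sum.cartesian_product[of "\<lambda>a b. pmf (D G v) (a, b)" "{b}" B] by simp
  ultimately have "x u v + (\<Sum>w\<in>I - {Some u}. of_bool (gone h w) * pmf (D G v) (w, Some u))
      = sum (pmf (D G v)) ({Some u} \<times> I) + sum (pmf (D G v)) (K \<times> {Some u})"
    using D_row[OF u(1) v] by (simp only:)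
  also have "\<dots> = sum (pmf (D G v)) ({Some u} \<times> I \<union> K \<times> {Some u})"
    using fin K by (intro sum.union_disjoint[symmetric]) (auto simp: K_def)
  also have "\<dots> = measure (D G v) ({Some u} \<times> I \<union> K \<times> {Some u})"
    using fin K by (intro measure_measure_pmf_finite[symmetric]) auto
  also have "\<dots> \<le> measure (D G v) ((\<lambda>(a, b). if usable G h v a then a
      else if usable G h v b then b else None) -` {Some u})"
    using ok by (intro measure_pmf.finite_measure_mono) (auto simp: K_def gone_def usable_def)
  finally show ?thesis by (simp add: two_choice_def)
next
  case False
  then have x0: "x u v = 0" using x_non_edge u v by blast
  have "(\<Sum>w\<in>I - {Some u}. of_bool (gone h w) * pmf (D G v) (w, Some u))
      \<le> (\<Sum>w\<in>I - {Some u}. pmf (D G v) (w, Some u))"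
    by (intro sum_mono) auto
  also have "\<dots> = 0" using D_column[OF u(1) v] x0 by simp
  finally show ?thesis using x0 measure_nonneg[of "two_choice D G h v" "{Some u}"] by linarith
qed

lemma probe_rate_ge:
  assumes "u \<in> Offline G" "u \<notin> matched h"
  shows "y u + (\<Sum>w\<in>I - {Some u}. of_bool (gone h w) * s w u)
    \<le> p * (\<Sum>v\<in>Online G. measure (two_choice D G h v) {Some u})"
proof -
  have "(\<Sum>w\<in>I - {Some u}. of_bool (gone h w) * s w u)
      = (\<Sum>w\<in>I - {Some u}. \<Sum>v\<in>Online G. p * (of_bool (gone h w) * pmf (D G v) (w, Some u)))"
    by (simp add: s_def sum_distrib_left mult.left_commute)
  also have "\<dots> = p * (\<Sum>v\<in>Online G. \<Sum>w\<in>I - {Some u}. of_bool (gone h w) * pmf (D G v) (w, Some u))"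
    by (subst sum.swap) (simp add: sum_distrib_left)
  finally have "y u + (\<Sum>w\<in>I - {Some u}. of_bool (gone h w) * s w u)
      = p * (\<Sum>v\<in>Online G. x u v + (\<Sum>w\<in>I - {Some u}. of_bool (gone h w) * pmf (D G v) (w, Some u)))"
    by (simp add: y_def sum.distrib distrib_left)
  also have "\<dots> \<le> p * (\<Sum>v\<in>Online G. measure (two_choice D G h v) {Some u})"
    using p probe_prob_ge[OF assms] by (intro mult_left_mono sum_mono) auto
  finally show ?thesis .
qed

text \<open>While both are free, each is probed at least at its first-choice rate, and one arrival
  cannot probe both, so the rates add up.\<close>

lemma pair_avoid_step:
  assumes u: "u \<in> Offline G" and w: "w \<in> Offline G" and "u \<noteq> w"
  shows "P {u, w} (Suc k) \<le> (1 - (y u + y w) / n) * P {u, w} k"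
proof -
  have hit: "(y u + y w) / n \<le> p * (\<Sum>v\<in>Online G. measure (two_choice D G h v) (Some ` {u, w})) / n"
    if "{u, w} \<inter> matched h = {}" for h
  proof -
    have ge: "y z \<le> p * (\<Sum>v\<in>Online G. measure (two_choice D G h v) {Some z})" if "z \<in> {u, w}" for z
      using probe_rate_ge[of z h] that u w \<open>{u, w} \<inter> matched h = {}\<close> s_nonneg
        sum_nonneg[of "I - {Some z}" "\<lambda>w. of_bool (gone h w) * s w z"] by auto
    have "measure (two_choice D G h v) (Some ` {u, w})
        = measure (two_choice D G h v) {Some u} + measure (two_choice D G h v) {Some w}" for v
      using \<open>u \<noteq> w\<close> by (simp add: measure_measure_pmf_finite)
    then show ?thesis using ge[of u] ge[of w]
      by (intro divide_right_mono) (simp_all add: sum.distrib distrib_left)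
  qed
  have "P {u, w} (Suc k) \<le> measure_pmf.expectation (online_run p (two_choice D) G k)
      (\<lambda>h. (1 - (y u + y w) / n) * avoids {u, w} h)"
    unfolding avoid_prob_Suc[OF p fin(2,3)]
  proof (rule integral_mono_AE)
    let ?M = "online_run p (two_choice D) G k"
    let ?f = "\<lambda>h. avoids {u, w} h
      * (1 - p * (\<Sum>v\<in>Online G. measure (two_choice D G h v) (Some ` {u, w})) / n)"
    show "integrable ?M ?f" by (rule integrable_avoids_step[OF p fin(2,3)])
    show "integrable ?M (\<lambda>h. (1 - (y u + y w) / n) * avoids {u, w} h)"
      by (intro integrable_mult_right integrable_pmf_bounded[where B = 1]) simp
    show "AE h in ?M. ?f h \<le> (1 - (y u + y w) / n) * avoids {u, w} h"
    proof (rule AE_pmfI)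
      fix h
      show "?f h \<le> (1 - (y u + y w) / n) * avoids {u, w} h"
        using hit[of h] by (cases "{u, w} \<inter> matched h = {}") simp_all
    qed
  qed
  then show ?thesis by (simp add: avoid_prob_def)
qed

lemma pair_avoid_le:
  assumes "u \<in> Offline G" "w \<in> Offline G" "u \<noteq> w"
  shows "P {u, w} k \<le> (1 - (y u + y w) / n) ^ k"
proof (induction k)
  case (Suc k)
  have "0 \<le> 1 - (y u + y w) / n" using y01[of u] y01[of w] assms two_le by (simp add: field_simps)
  then have "(1 - (y u + y w) / n) * P {u, w} k \<le> (1 - (y u + y w) / n) ^ Suc k"
    using Suc by (simp add: mult_left_mono)
  then show ?case using pair_avoid_step[OF assms, of k] by (rule order_trans[rotated])
qed simp

definition joint_avoid :: "'u \<Rightarrow> 'u option \<Rightarrow> nat \<Rightarrow> real" where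
  "joint_avoid u w k = (case w of None \<Rightarrow> 0 | Some w' \<Rightarrow> P {u, w'} k)"

text \<open>The rate of \<open>None\<close> is set to 1, the largest possible one, so that \<open>sum_Y_ge\<close> holds.\<close>

definition y_opt :: "'u option \<Rightarrow> real" where
  "y_opt = case_option 1 y"

definition Y :: "'u \<Rightarrow> real" where
  "Y u = (\<Sum>w\<in>I - {Some u}. s w u * y_opt w)"

lemma y_opt01: "w \<in> I \<Longrightarrow> 0 \<le> y_opt w" "w \<in> I \<Longrightarrow> y_opt w \<le> 1"
  using y01 by (auto simp: y_opt_def)

text \<open>Second choices help \<open>u\<close> at the full rate \<open>S u\<close>, except for
  pairs whose first choice is still free. Those are subtracted through joint survival probabilities,
  which are bounded separately.\<close>

lemma avoid_step:
  assumes u: "u \<in> Offline G"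
  shows "P {u} (Suc k) \<le> (1 - y u / n) * P {u} k
    - (S u * P {u} k - (\<Sum>w\<in>I - {Some u}. s w u * joint_avoid u w k)) / n"
proof -
  let ?M = "online_run p (two_choice D) G k"
  let ?both = "\<lambda>h w. case w of None \<Rightarrow> 0 | Some w' \<Rightarrow> avoids {u, w'} h"
  let ?g = "\<lambda>h. (1 - y u / n) * avoids {u} h
    - (S u * avoids {u} h - (\<Sum>w\<in>I - {Some u}. s w u * ?both h w)) / n"
  have int1: "integrable ?M (\<lambda>h. of_bool (B h) :: real)" for B by (rule integrable_pmf_bounded[where B = 1]) simp
  have int2: "integrable ?M (\<lambda>h. ?both h w)" for w
    by (cases w) (auto intro: integrable_pmf_bounded[where B = 1])
  have "P {u} (Suc k) \<le> measure_pmf.expectation ?M ?g"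
    unfolding avoid_prob_Suc[OF p fin(2,3)]
  proof (rule integral_mono)
    show "integrable ?M (\<lambda>h. avoids {u} h
      * (1 - p * (\<Sum>v\<in>Online G. measure (two_choice D G h v) (Some ` {u})) / n))"
      by (rule integrable_avoids_step[OF p fin(2,3)])
    show "integrable ?M ?g" using int1 int2 by simp
    fix h
    show "avoids {u} h * (1 - p * (\<Sum>v\<in>Online G. measure (two_choice D G h v) (Some ` {u})) / n) \<le> ?g h"
    proof (cases "u \<in> matched h")
      case True
      then have "?both h w = 0" for w by (cases w) simp_all
      then show ?thesis using True by simp
    next
      case False
      have "s w u * ?both h w = s w u - of_bool (gone h w) * s w u" for w
        using False by (cases w) (simp_all add: gone_def)
      then have "S u - (\<Sum>w\<in>I - {Some u}. s w u * ?both h w)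
          = (\<Sum>w\<in>I - {Some u}. of_bool (gone h w) * s w u)"
        by (simp add: sum_subtractf S_def)
      then have "y u + (S u - (\<Sum>w\<in>I - {Some u}. s w u * ?both h w))
          \<le> p * (\<Sum>v\<in>Online G. measure (two_choice D G h v) {Some u})"
        using probe_rate_ge[OF u False] by simp
      then have "(y u + (S u - (\<Sum>w\<in>I - {Some u}. s w u * ?both h w))) / n
          \<le> p * (\<Sum>v\<in>Online G. measure (two_choice D G h v) {Some u}) / n"
        by (rule divide_right_mono) simp
      then show ?thesis using False by (simp add: add_divide_distrib diff_divide_distrib)
    qed
  qed
  also have "measure_pmf.expectation ?M ?g = (1 - y u / n) * P {u} k
    - (S u * P {u} k - (\<Sum>w\<in>I - {Some u}. s w u * joint_avoid u w k)) / n"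
  proof -
    have "measure_pmf.expectation ?M (\<lambda>h. ?both h w) = joint_avoid u w k" for w
      by (cases w) (simp_all add: joint_avoid_def avoid_prob_def)
    then show ?thesis using int1 int2
      by (simp add: avoid_prob_def Bochner_Integration.integral_sum)
  qed
  finally show ?thesis .
qed

text \<open>\<open>1 - a - b \<le> (1 - a) * (1 - b)\<close> separates the two vertices. The power
  for \<open>u\<close> is kept, as the recursion divides it out; the one for \<open>w\<close> is
  replaced by its bound linear in the rate.\<close>

lemma joint_avoid_le:
  assumes u: "u \<in> Offline G" and w: "w \<in> I - {Some u}"
  shows "joint_avoid u w k \<le> P {u} k"
    and "joint_avoid u w k \<le> (1 - y u / n) ^ k * (1 - y_opt w * (1 - (1 - 1 / n) ^ k))"
proof -
  show "joint_avoid u w k \<le> P {u} k"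
    by (cases w) (simp_all add: joint_avoid_def avoid_prob_nonneg avoid_prob_antimono)
  have \<alpha>: "0 \<le> 1 - y u / n" using y01[OF u] two_le by (simp add: field_simps)
  show "joint_avoid u w k \<le> (1 - y u / n) ^ k * (1 - y_opt w * (1 - (1 - 1 / n) ^ k))"
  proof (cases w)
    case None
    then show ?thesis using \<alpha> two_le by (simp add: joint_avoid_def y_opt_def)
  next
    case (Some z)
    then have z: "z \<in> Offline G" "u \<noteq> z" using w by auto
    have "joint_avoid u w k \<le> (1 - (y u + y z) / n) ^ k" using pair_avoid_le[OF u z] Some by (simp add: joint_avoid_def)
    also have "\<dots> \<le> ((1 - y u / n) * (1 - y z / n)) ^ k"
    proof (rule power_mono)
      have "0 \<le> (y u / n) * (y z / n)" using y01 u z by simp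
      then show "1 - (y u + y z) / n \<le> (1 - y u / n) * (1 - y z / n)"
        by (simp add: algebra_simps add_divide_distrib)
      show "0 \<le> 1 - (y u + y z) / n"
        using y01[OF u] y01[OF z(1)] two_le by (simp add: field_simps)
    qed
    also have "\<dots> \<le> (1 - y u / n) ^ k * (1 - y z * (1 - (1 - 1 / n) ^ k))"
      unfolding power_mult_distrib using \<alpha> y01[OF z(1)] two_le
      by (intro mult_left_mono power_one_minus_le_interpolation) auto
    finally show ?thesis using Some by (simp add: y_opt_def)
  qed
qed

lemma Y_nonneg: "0 \<le> Y u"
  unfolding Y_def using s_nonneg y_opt01 by (intro sum_nonneg mult_nonneg_nonneg) auto

lemma Y_le_S: "Y u \<le> S u"
  unfolding Y_def S_def using s_nonneg y_opt01 by (intro sum_mono mult_left_le) auto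

text \<open>
  The symmetry of \<open>s\<close> moves the credit for an ordered pair from one endpoint to the other. This is
  what makes vertices of small rate harmless: they are bad first choices for others, but they gain
  as second choices.
\<close>

lemma sum_Y_ge: "(\<Sum>u\<in>Offline G. y u * S u) \<le> (\<Sum>u\<in>Offline G. Y u)"
proof -
  have split: "(\<Sum>w\<in>I - {Some u}. F w) = F None + (\<Sum>w\<in>Offline G. if w = u then 0 else F (Some w))"
    for u and F :: "'u option \<Rightarrow> real"
  proof -
    have "I - {Some u} = insert None (Some ` (Offline G - {u}))" by auto
    then have "(\<Sum>w\<in>I - {Some u}. F w) = F None + (\<Sum>w\<in>Offline G - {u}. F (Some w))"
      using fin by (simp add: sum.reindex)
    also have "(\<Sum>w\<in>Offline G - {u}. F (Some w)) = (\<Sum>w\<in>Offline G. if w = u then 0 else F (Some w))"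
      using fin by (intro sum.mono_neutral_cong_left) auto
    finally show ?thesis .
  qed
  have "(\<Sum>u\<in>Offline G. y u * S u) = (\<Sum>u\<in>Offline G. y u * s None u)
      + (\<Sum>u\<in>Offline G. \<Sum>w\<in>Offline G. if w = u then 0 else y u * s (Some w) u)"
    by (simp add: S_def split sum.distrib distrib_left sum_distrib_left if_distrib cong: if_cong)
  also have "\<dots> \<le> (\<Sum>u\<in>Offline G. s None u)
      + (\<Sum>u\<in>Offline G. \<Sum>w\<in>Offline G. if w = u then 0 else y u * s (Some w) u)"
    using y01 s_nonneg by (intro add_right_mono sum_mono mult_left_le_one_le) auto
  also have "(\<Sum>u\<in>Offline G. \<Sum>w\<in>Offline G. if w = u then 0 else y u * s (Some w) u)
      = (\<Sum>w\<in>Offline G. \<Sum>u\<in>Offline G. if u = w then 0 else s (Some u) w * y u)"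
    by (subst sum.swap) (auto intro!: sum.cong simp: s_commute)
  also have "(\<Sum>u\<in>Offline G. s None u) + \<dots> = (\<Sum>u\<in>Offline G. Y u)"
    by (simp add: Y_def split y_opt_def sum.distrib cong: if_cong)
  finally show ?thesis .
qed

text \<open>The power \<open>(1 - y u / n) ^ n\<close> is bounded by \<open>exp (- y u)\<close> from
  above in the main term and by \<open>Q\<close> from below in the gain, the latter because
  \<open>y u \<le> 1\<close>.\<close>

lemma match_prob_ge:
  fixes Q :: real
  assumes u: "u \<in> Offline G" and Q: "Q = (1 - 1 / n) ^ n" "0.3675 \<le> Q"
  shows "1 - exp (- y u) + Q * (Y u * (Q - S u * (1 / 2 - Q))) \<le> 1 - P {u} n"
proof -
  define \<alpha> where "\<alpha> = 1 - y u / n"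
  define c where "c = Y u * (Q - S u * (1 / 2 - Q))"
  have S1: "S u \<le> 1" using S_le[OF u] y01[OF u] by simp
  have le: "P {u} n \<le> \<alpha> ^ n * (1 - c)"
    unfolding \<alpha>_def c_def Q(1)
  proof (rule two_choice_recursion[where G = "\<lambda>k. \<Sum>w\<in>I - {Some u}. s w u * joint_avoid u w k"])
    show "(\<Sum>w\<in>I - {Some u}. s w u * joint_avoid u w k) \<le> S u * P {u} k" for k
      unfolding S_def sum_distrib_right using s_nonneg joint_avoid_le(1)[OF u]
      by (intro sum_mono mult_left_mono) auto
    show "(\<Sum>w\<in>I - {Some u}. s w u * joint_avoid u w k)
        \<le> (1 - y u / n) ^ k * (S u - Y u * (1 - (1 - 1 / n) ^ k))" for k
    proof -
      have "(\<Sum>w\<in>I - {Some u}. s w u * joint_avoid u w k)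
          \<le> (\<Sum>w\<in>I - {Some u}. s w u * ((1 - y u / n) ^ k * (1 - y_opt w * (1 - (1 - 1 / n) ^ k))))"
        using s_nonneg joint_avoid_le(2)[OF u] by (intro sum_mono mult_left_mono) auto
      also have "\<dots> = (1 - y u / n) ^ k * (S u - Y u * (1 - (1 - 1 / n) ^ k))"
        by (simp add: S_def Y_def sum_distrib_left sum_distrib_right sum_subtractf[symmetric] algebra_simps)
      finally show ?thesis .
    qed
  qed (use two_le y01[OF u] S_nonneg S1 Y_nonneg avoid_step[OF u] in auto)
  \<comment> \<open>\<open>Q - S u * (1 / 2 - Q)\<close> written as a convex combination with weight
    \<open>S u\<close>; both parts are nonnegative as \<open>Q\<close> exceeds 1/4.\<close>
  have "0 \<le> S u * (2 * Q - 1 / 2) + (1 - S u) * Q" using S_nonneg[of u] S1 Q by (intro add_nonneg_nonneg mult_nonneg_nonneg) auto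
  then have c: "0 \<le> c" unfolding c_def by (intro mult_nonneg_nonneg Y_nonneg) (simp add: algebra_simps)
  have "\<alpha> ^ n \<le> exp (- y u)"
    unfolding \<alpha>_def using y01[OF u] two_le by (intro exp_ge_one_minus_x_over_n_power_n) auto
  moreover have "Q \<le> \<alpha> ^ n"
    unfolding \<alpha>_def Q(1) using y01[OF u] two_le by (intro power_mono) (auto simp: divide_right_mono)
  then have "Q * c \<le> \<alpha> ^ n * c" using c by (rule mult_right_mono)
  ultimately show ?thesis using le unfolding c_def[symmetric] by (simp add: algebra_simps)
qed

text \<open>For a single vertex \<open>Y u\<close> may be smaller than \<open>y u * S u\<close>;
  only the sums compare. So the per-vertex inequality is summed first and the exchange is made
  afterwards.\<close>

lemma expected_ALG_ge:
  fixes Q :: real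
  assumes Q: "Q = (1 - 1 / n) ^ n" "0.3675 \<le> Q"
    and S: "\<And>u. u \<in> Offline G \<Longrightarrow> y u - 0.3075 \<le> S u"
  shows "0.702 * (\<Sum>u\<in>Offline G. y u) \<le> expected_ALG p (two_choice D) G"
proof -
  have "Q \<le> exp (- 1)" unfolding Q(1) using two_le by (intro exp_ge_one_minus_x_over_n_power_n) auto
  then have Q2: "Q \<le> 1 / 2" using exp_minus_1 by simp
  have "0.702 * (\<Sum>u\<in>Offline G. y u)
      \<le> (\<Sum>u\<in>Offline G. 1 - exp (- y u) + Q * (Q * (y u * S u) - (1 / 2 - Q) * (S u)\<^sup>2))"
    unfolding sum_distrib_left using y01 S_nonneg S_le S Q Q2
    by (intro sum_mono two_choice_ratio) auto
  also have "\<dots> = (\<Sum>u\<in>Offline G. 1 - exp (- y u))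
      + Q * (Q * (\<Sum>u\<in>Offline G. y u * S u) - (1 / 2 - Q) * (\<Sum>u\<in>Offline G. (S u)\<^sup>2))"
    by (simp add: sum.distrib sum_subtractf right_diff_distrib sum_distrib_left)
  also have "\<dots> \<le> (\<Sum>u\<in>Offline G. 1 - exp (- y u))
      + Q * (Q * (\<Sum>u\<in>Offline G. Y u) - (1 / 2 - Q) * (\<Sum>u\<in>Offline G. Y u * S u))"
  proof -
    have "(\<Sum>u\<in>Offline G. Y u * S u) \<le> (\<Sum>u\<in>Offline G. (S u)\<^sup>2)"
      unfolding power2_eq_square using Y_le_S S_nonneg by (intro sum_mono mult_right_mono)
    then show ?thesis using sum_Y_ge Q Q2
      by (intro add_left_mono mult_left_mono diff_mono) auto
  qed
  also have "\<dots> = (\<Sum>u\<in>Offline G. 1 - exp (- y u) + Q * (Y u * (Q - S u * (1 / 2 - Q))))"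
    by (simp add: sum.distrib sum_subtractf sum_distrib_left algebra_simps)
  also have "\<dots> \<le> (\<Sum>u\<in>Offline G. 1 - P {u} n)"
    using match_prob_ge Q by (intro sum_mono) auto
  also have "\<dots> \<le> expected_ALG p (two_choice D) G"
    using fin by (intro sum_unmatched_le_expected_ALG)
  finally show ?thesis .
qed

end

section \<open>Pairs built from the offline match rates, and the competitive ratio\<close>

definition choice_pair :: "real \<Rightarrow> ('u, 'v) bigraph \<Rightarrow> 'v \<Rightarrow> ('u option \<times> 'u option) pmf" where
  "choice_pair p G v = (SOME D. (\<forall>a b. pmf D (a, b) = pmf D (b, a)) \<and>
    (\<forall>u\<in>Offline G. (\<Sum>b\<in>insert None (Some ` Offline G). pmf D (Some u, b)) = match_rate p G u v / p) \<and>
    (\<forall>u\<in>Offline G. pmf D (Some u, Some u) = max 0 (2 * (match_rate p G u v / p) - 1)))"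

lemma two_choice_instance_choice_pair:
  assumes p: "0 < p" "p \<le> 1" and bip: "bipartite_graph G" and two_le: "2 \<le> card (Online G)"
  shows "two_choice_instance p G (choice_pair p) (\<lambda>u v. match_rate p G u v / p)"
proof -
  have ne: "Online G \<noteq> {}" using two_le by auto
  have p': "0 \<le> p" using p by simp
  have fin: "finite (Offline G)" using bip by (simp add: bipartite_graph_def)
  have D: "(\<forall>a b. pmf (choice_pair p G v) (a, b) = pmf (choice_pair p G v) (b, a)) \<and>
    (\<forall>u\<in>Offline G. (\<Sum>b\<in>insert None (Some ` Offline G). pmf (choice_pair p G v) (Some u, b))
      = match_rate p G u v / p) \<and>
    (\<forall>u\<in>Offline G. pmf (choice_pair p G v) (Some u, Some u) = max 0 (2 * (match_rate p G u v / p) - 1))"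
    if "v \<in> Online G" for v
    unfolding choice_pair_def
  proof (rule someI_ex, rule symmetric_pair_pmf_exists[OF fin])
    show "0 \<le> match_rate p G u v / p" for u
      using match_rate_nonneg[OF p' p(2) bip ne] p by simp
    have "(\<Sum>u\<in>Offline G. match_rate p G u v) / p \<le> p / p"
      using sum_match_rate_type_le[OF p' p(2) bip ne that] p by (intro divide_right_mono) auto
    then show "(\<Sum>u\<in>Offline G. match_rate p G u v / p) \<le> 1"
      using p by (simp add: sum_divide_distrib)
  qed
  show ?thesis
  proof
    fix u
    have "0 \<le> (1 - p) ^ card (Online G)" using p by simp
    then have "(\<Sum>v\<in>Online G. match_rate p G u v) \<le> 1"
      using sum_match_rate_vertex_le[OF p' p(2) bip ne order_refl, of u] two_le by simp
    then show "p * (\<Sum>v\<in>Online G. match_rate p G u v / p) \<le> 1"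
      using p by (simp flip: sum_divide_distrib)
    show "pmf (choice_pair p G v) (a, b) = pmf (choice_pair p G v) (b, a)" if "v \<in> Online G" for v a b
      using D[OF that] by blast
    show "(\<Sum>b\<in>insert None (Some ` Offline G). pmf (choice_pair p G v) (Some u, b)) = match_rate p G u v / p"
      "pmf (choice_pair p G v) (Some u, Some u) = max 0 (2 * (match_rate p G u v / p) - 1)"
      if "u \<in> Offline G" "v \<in> Online G" for u v
      using D[OF that(2)] that(1) by blast+
  qed (use p bip two_le match_rate_non_edge[OF p' p(2) bip ne] in auto)
qed

text \<open>The size conditions are explicit: 16000 serves the bound on the diagonal, and 0.3675
  lies just below the limit \<open>exp (- 1)\<close>.\<close>

lemma competitive_ratio_two_choice_ge:
  assumes pos: "0 < p" and le1: "p \<le> 1" and bip: "bipartite_graph G" and edges: "Edges G \<noteq> {}"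
    and n: "16000 \<le> card (Online G)" "0.3675 \<le> (1 - 1 / card (Online G)) ^ card (Online G)"
  shows "0.702 \<le> competitive_ratio p (two_choice (choice_pair p)) G"
proof -
  have two_le: "2 \<le> card (Online G)" using n by simp
  interpret two_choice_instance p G "choice_pair p" "\<lambda>u v. match_rate p G u v / p"
    by (rule two_choice_instance_choice_pair[OF pos le1 bip two_le])
  have p': "0 \<le> p" using pos by simp
  have y_eq: "y u = (\<Sum>v\<in>Online G. match_rate p G u v)" for u
    using pos le1 by (simp add: y_def flip: sum_divide_distrib)
  have "y u - 0.3075 \<le> S u" if u: "u \<in> Offline G" for u
  proof -
    \<comment> \<open>The types with a positive summand: on them the maximum disappears, and the set
      bound applies with \<open>m = p * card X\<close>.\<close>
    define X where "X = {v \<in> Online G. p < 2 * match_rate p G u v}"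
    have X: "finite X" "X \<subseteq> Online G" using fin by (auto simp: X_def)
    have "(\<Sum>v\<in>Online G. max 0 (2 * (p * (match_rate p G u v / p)) - p))
        = (\<Sum>v\<in>X. 2 * match_rate p G u v - p)"
      using fin pos by (intro sum.mono_neutral_cong_right) (auto simp: X_def)
    also have "\<dots> = 2 * (\<Sum>v\<in>X. match_rate p G u v) - p * card X"
      by (simp add: sum_subtractf sum_distrib_left)
    also have "\<dots> \<le> 0.3075"
    proof (rule overlap_bound)
      have "p * card X \<le> 1 * real (card (Online G))"
        using pos le1 card_mono[OF fin(2) X(2)] by (intro mult_mono) auto
      then show "p * card X \<le> real (card (Online G))" by simp
    qed (use pos n sum_match_rate_vertex_le[OF p' le1 bip fin(3) X(2)] in auto)
    finally show ?thesis using S_eq[OF u] by simp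
  qed
  then have "0.702 * (\<Sum>u\<in>Offline G. y u) \<le> expected_ALG p (two_choice (choice_pair p)) G"
    using n by (intro expected_ALG_ge) auto
  moreover have "(\<Sum>u\<in>Offline G. y u) = expected_OPT p G"
    by (simp add: y_eq sum_match_rate[OF p' le1 bip fin(3)])
  moreover have "0 < expected_OPT p G"
    by (rule expected_OPT_pos[OF p' le1 bip fin(3) pos edges])
  ultimately show ?thesis by (simp add: competitive_ratio_def field_simps)
qed

theorem theorem4:
  fixes p :: real
  assumes "0 < p" and "p \<le> 1"
  shows "\<exists>A :: ('u, 'v) online_algorithm. admissible A \<and>
    (\<forall>\<epsilon> > 0. \<forall>\<^sub>F n in sequentially. \<forall>G :: ('u, 'v) bigraph.
       bipartite_graph G \<and> card (Online G) = n \<and> Edges G \<noteq> {} \<longrightarrow>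
       competitive_ratio p A G \<ge> 0.702 - \<epsilon>)"
proof (intro exI conjI allI impI)
  show "admissible (two_choice (choice_pair p) :: ('u, 'v) online_algorithm)"
    by (rule admissible_two_choice)
  fix \<epsilon> :: real assume "0 < \<epsilon>"
  \<comment> \<open>The limit lies strictly above 0.3675, so the second size condition holds from
    some \<open>n\<close> on.\<close>
  have "(\<lambda>n. (1 + (- 1) / real n) ^ n) \<longlonglongrightarrow> exp (- 1)"
    by (rule tendsto_exp_limit_sequentially)
  then have "\<forall>\<^sub>F n in sequentially. 0.3675 < (1 + (- 1) / real n) ^ n"
    using exp_minus_1(2) by (rule order_tendstoD)
  then show "\<forall>\<^sub>F n in sequentially. \<forall>G :: ('u, 'v) bigraph.
      bipartite_graph G \<and> card (Online G) = n \<and> Edges G \<noteq> {} \<longrightarrow>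
      competitive_ratio p (two_choice (choice_pair p)) G \<ge> 0.702 - \<epsilon>"
    using eventually_ge_at_top[of 16000]
  proof eventually_elim
    case (elim n)
    show ?case
    proof (intro allI impI)
      fix G :: "('u, 'v) bigraph"
      assume G: "bipartite_graph G \<and> card (Online G) = n \<and> Edges G \<noteq> {}"
      then have "0.702 \<le> competitive_ratio p (two_choice (choice_pair p)) G"
        using elim assms by (intro competitive_ratio_two_choice_ge) auto
      then show "competitive_ratio p (two_choice (choice_pair p)) G \<ge> 0.702 - \<epsilon>"
        using \<open>0 < \<epsilon>\<close> by linarith
    qed
  qed
qed

end
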